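(* Let $R\subset S$ be a ring extension such that $|\mathrm{Supp}(S/R)|=2$ and $\mathrm{Supp}(S/R)\subseteq\mathrm{Max}(R)$. The following conditions are equivalent: (1) $\ell[R,S]=2$; (2) $R\subset S$ is locally minimal; (3) $|[R,S]|=4$. If these conditions hold, then $R\subset S$ is simple.
   Context: Rings are commutative and unital; $R\subset S$ denotes a proper ring extension and $[R,S]$ the set of all $R$-subalgebras of $S$. The length $\ell[R,S]$ is the supremum of the lengths $n$ of chains $R_0\subset R_1\subset\cdots\subset R_n$ of elements of $[R,S]$. An extension $A\subset B$ ($A\neq B$) is minimal if $[A,B]=\{A,B\}$. $\mathrm{Supp}(S/R)=\{P\in\mathrm{Spec}(R)\mid (S/R)_P\neq 0\}$. For $P\in\mathrm{Spec}(R)$, $S_P=S_{R\setminus P}$. $R\subset S$ is locally minimal if $R_M\subset S_M$ is minimal for each $M\in\mathrm{Supp}(S/R)$. $R\subset S$ is simple if $S=R[t]$ for some $t\in S$. *)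

theory Defs
  imports "HOL-Library.Extended_Nat" "HOL-Algebra.Finite_Extensions"
begin

text \<open>
  A ring extension is given by a commutative ring \<open>S\<close> together with a subring
  \<open>R \<subseteq> carrier S\<close>; as a ring, \<open>R\<close> is \<open>S\<lparr>carrier := R\<rparr>\<close>.
\<close>

definition ring_extension :: "('a, 'b) ring_scheme \<Rightarrow> 'a set \<Rightarrow> bool"
  where "ring_extension S R \<longleftrightarrow> cring S \<and> subring R S \<and> R \<noteq> carrier S"


subsection \<open>Intermediate algebras, length, minimal and simple extensions\<close>

text \<open>
  The library's \<^const>\<open>subalgebra\<close> does not ask for the unit element, hence the conjunction.
\<close>

definition subalgebras :: "('a, 'b) ring_scheme \<Rightarrow> 'a set \<Rightarrow> 'a set set"
  where "subalgebras S R = {T. subring T S \<and> subalgebra R T S}"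

lemma subalgebras_eq:
  assumes "cring S" "subring R S"
  shows "subalgebras S R = {T. subring T S \<and> R \<subseteq> T}"
proof -
  interpret cring S by fact
  have "R \<subseteq> T" if "subring T S" "subalgebra R T S" for T
  proof
    fix r assume r: "r \<in> R"
    hence "r \<otimes>\<^bsub>S\<^esub> \<one>\<^bsub>S\<^esub> \<in> T"
      using subalgebra.smult_closed[OF that(2)] subringE(3)[OF that(1)] by blast
    thus "r \<in> T"
      using r subringE(1)[OF assms(2)] by auto
  qed
  moreover have "subalgebra R T S" if "subring T S" "R \<subseteq> T" for T
    using that subring.axioms(1)[OF that(1)] subringE(6)[OF that(1)]
    by (auto simp: subalgebra_def subalgebra_axioms_def)
  ultimately show ?thesis
    by (auto simp: subalgebras_def)
qed

definition ext_length :: "('a, 'b) ring_scheme \<Rightarrow> 'a set \<Rightarrow> enat"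
  where "ext_length S R =
    Sup {enat n | n. \<exists>C :: nat \<Rightarrow> 'a set.
           (\<forall>i\<le>n. C i \<in> subalgebras S R) \<and> (\<forall>i<n. C i \<subset> C (Suc i))}"

definition minimal_extension :: "('a, 'b) ring_scheme \<Rightarrow> 'a set \<Rightarrow> bool"
  where "minimal_extension S R \<longleftrightarrow>
    ring_extension S R \<and> subalgebras S R = {R, carrier S}"

definition simple_ring_extension :: "('a, 'b) ring_scheme \<Rightarrow> 'a set \<Rightarrow> bool"
  where "simple_ring_extension S R \<longleftrightarrow>
    (\<exists>t\<in>carrier S. carrier S = ring.simple_extension S R t)"


subsection \<open>Localization of rings\<close>

definition loc_rel :: "('a, 'b) ring_scheme \<Rightarrow> 'a set \<Rightarrow> (('a \<times> 'a) \<times> ('a \<times> 'a)) set"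
  where "loc_rel A T =
    {((a, s), (b, t)). a \<in> carrier A \<and> s \<in> T \<and> b \<in> carrier A \<and> t \<in> T \<and>
       (\<exists>u\<in>T. u \<otimes>\<^bsub>A\<^esub> (t \<otimes>\<^bsub>A\<^esub> a \<ominus>\<^bsub>A\<^esub> s \<otimes>\<^bsub>A\<^esub> b) = \<zero>\<^bsub>A\<^esub>)}"

definition frac :: "('a, 'b) ring_scheme \<Rightarrow> 'a set \<Rightarrow> 'a \<Rightarrow> 'a \<Rightarrow> ('a \<times> 'a) set"
  where "frac A T a s = loc_rel A T `` {(a, s)}"

definition ring_loc :: "('a, 'b) ring_scheme \<Rightarrow> 'a set \<Rightarrow> ('a \<times> 'a) set ring"
  where "ring_loc A T =
    \<lparr>carrier = (carrier A \<times> T) // loc_rel A T,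
     mult = (\<lambda>U V. \<Union>(a, s)\<in>U. \<Union>(b, t)\<in>V. frac A T (a \<otimes>\<^bsub>A\<^esub> b) (s \<otimes>\<^bsub>A\<^esub> t)),
     one = frac A T \<one>\<^bsub>A\<^esub> \<one>\<^bsub>A\<^esub>,
     zero = frac A T \<zero>\<^bsub>A\<^esub> \<one>\<^bsub>A\<^esub>,
     add = (\<lambda>U V. \<Union>(a, s)\<in>U. \<Union>(b, t)\<in>V.
              frac A T (t \<otimes>\<^bsub>A\<^esub> a \<oplus>\<^bsub>A\<^esub> s \<otimes>\<^bsub>A\<^esub> b) (s \<otimes>\<^bsub>A\<^esub> t))\<rparr>"

text \<open>
  For a subring \<open>R\<close> of \<open>S\<close> containing \<open>T\<close>, the map from the localization of \<open>R\<close> to that of \<open>S\<close>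
  induced by the inclusion; it is always injective, and the localization of \<open>R\<close> is identified
  with its image.
\<close>

definition loc_incl :: "('a, 'b) ring_scheme \<Rightarrow> 'a set \<Rightarrow> ('a \<times> 'a) set \<Rightarrow> ('a \<times> 'a) set"
  where "loc_incl S T U = (\<Union>(r, t)\<in>U. frac S T r t)"

definition ring_at :: "('a, 'b) ring_scheme \<Rightarrow> 'a set \<Rightarrow> 'a set \<Rightarrow> ('a \<times> 'a) set ring"
  where "ring_at S R P = ring_loc S (R - P)"

definition base_at :: "('a, 'b) ring_scheme \<Rightarrow> 'a set \<Rightarrow> 'a set \<Rightarrow> ('a \<times> 'a) set set"
  where "base_at S R P = loc_incl S (R - P) ` carrier (ring_loc (S\<lparr>carrier := R\<rparr>) (R - P))"


subsection \<open>Quotient modules, localization of modules, support\<close>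

text \<open>
  Modules are records extending rings; the unused fields \<^const>\<open>mult\<close> and \<^const>\<open>one\<close>
  are left undefined.
\<close>

definition ring_as_module :: "('a, 'b) ring_scheme \<Rightarrow> ('a, 'a) module"
  where "ring_as_module S =
    \<lparr>carrier = carrier S, mult = undefined, one = undefined,
     zero = \<zero>\<^bsub>S\<^esub>, add = add S, smult = mult S\<rparr>"

definition quot_module :: "('a, 'm, 'c) module_scheme \<Rightarrow> 'm set \<Rightarrow> ('a, 'm set) module"
  where "quot_module M N =
    \<lparr>carrier = a_rcosets\<^bsub>M\<^esub> N, mult = undefined, one = undefined,
     zero = N, add = set_add M,
     smult = (\<lambda>r U. \<Union>x\<in>U. N +>\<^bsub>M\<^esub> (r \<odot>\<^bsub>M\<^esub> x))\<rparr>"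

definition mod_loc_rel ::
    "('a, 'm, 'c) module_scheme \<Rightarrow> 'a set \<Rightarrow> (('m \<times> 'a) \<times> ('m \<times> 'a)) set"
  where "mod_loc_rel M T =
    {((x, s), (y, t)). x \<in> carrier M \<and> s \<in> T \<and> y \<in> carrier M \<and> t \<in> T \<and>
       (\<exists>u\<in>T. u \<odot>\<^bsub>M\<^esub> (t \<odot>\<^bsub>M\<^esub> x \<ominus>\<^bsub>M\<^esub> s \<odot>\<^bsub>M\<^esub> y) = \<zero>\<^bsub>M\<^esub>)}"

definition mod_frac ::
    "('a, 'm, 'c) module_scheme \<Rightarrow> 'a set \<Rightarrow> 'm \<Rightarrow> 'a \<Rightarrow> ('m \<times> 'a) set"
  where "mod_frac M T x s = mod_loc_rel M T `` {(x, s)}"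

text \<open>
  The localization of the \<open>A\<close>-module \<open>M\<close> at \<open>T \<subseteq> carrier A\<close>, a module over \<open>ring_loc A T\<close>.
\<close>

definition module_loc ::
    "('a, 'b) ring_scheme \<Rightarrow> ('a, 'm, 'c) module_scheme \<Rightarrow> 'a set
     \<Rightarrow> (('a \<times> 'a) set, ('m \<times> 'a) set) module"
  where "module_loc A M T =
    \<lparr>carrier = (carrier M \<times> T) // mod_loc_rel M T, mult = undefined, one = undefined,
     zero = mod_frac M T \<zero>\<^bsub>M\<^esub> \<one>\<^bsub>A\<^esub>,
     add = (\<lambda>U V. \<Union>(x, s)\<in>U. \<Union>(y, t)\<in>V.
              mod_frac M T (t \<odot>\<^bsub>M\<^esub> x \<oplus>\<^bsub>M\<^esub> s \<odot>\<^bsub>M\<^esub> y) (s \<otimes>\<^bsub>A\<^esub> t)),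
     smult = (\<lambda>U V. \<Union>(a, s)\<in>U. \<Union>(y, t)\<in>V. mod_frac M T (a \<odot>\<^bsub>M\<^esub> y) (s \<otimes>\<^bsub>A\<^esub> t))\<rparr>"

definition Spec :: "('a, 'b) ring_scheme \<Rightarrow> 'a set set"
  where "Spec A = {P. primeideal P A}"

definition Max_Spec :: "('a, 'b) ring_scheme \<Rightarrow> 'a set set"
  where "Max_Spec A = {M. maximalideal M A}"

definition module_support ::
    "('a, 'b) ring_scheme \<Rightarrow> ('a, 'm, 'c) module_scheme \<Rightarrow> 'a set set"
  where "module_support A M =
    {P \<in> Spec A. carrier (module_loc A M (carrier A - P)) \<noteq> {\<zero>\<^bsub>module_loc A M (carrier A - P)\<^esub>}}"

definition ext_support :: "('a, 'b) ring_scheme \<Rightarrow> 'a set \<Rightarrow> 'a set set"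
  where "ext_support S R =
    module_support (S\<lparr>carrier := R\<rparr>) (quot_module (ring_as_module S) R)"

definition locally_minimal :: "('a, 'b) ring_scheme \<Rightarrow> 'a set \<Rightarrow> bool"
  where "locally_minimal S R \<longleftrightarrow>
    (\<forall>M\<in>ext_support S R. minimal_extension (ring_at S R M) (base_at S R M))"

end

theory Submission
  imports Defs
begin

text \<open>
  For a prime \<open>P\<close> of \<open>R\<close>, let the saturation of an intermediate ring \<open>B\<close> at \<open>P\<close> consist of all
  \<open>a \<in> S\<close> with \<open>u a \<in> B\<close> for some \<open>u \<in> R - P\<close>. The intermediate rings of the localization
  at \<open>P\<close> correspond to the saturated elements of \<open>[R, S]\<close>, so that local minimality says that only
  \<open>S\<close> and the saturation of \<open>R\<close> are saturated. When the support consists of two maximal ideals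
  \<open>M\<close>, \<open>N\<close>, every \<open>B\<close> is the intersection of its saturations at \<open>M\<close> and \<open>N\<close>, while saturating
  \<open>R\<close> at both \<open>M\<close> and \<open>N\<close> gives \<open>S\<close>. Hence \<open>R\<close>, its two saturations \<open>A\<close>, \<open>C\<close> and \<open>S\<close> are always
  four distinct elements of \<open>[R, S]\<close> with \<open>A\<close>, \<open>C\<close> incomparable, and each of the three conditions
  says that there are no others. In that case \<open>a + c\<close> with \<open>a \<in> A - C\<close> and \<open>c \<in> C - A\<close> lies in no
  proper intermediate ring, so it generates \<open>S\<close>.
\<close>


subsection \<open>Subrings and prime ideals\<close>

lemma (in cring) subring_is_cring: "subring H R \<Longrightarrow> cring (R\<lparr>carrier := H\<rparr>)"
  using subcring_iff[OF subringE(1)] subcringI' by simp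

lemma (in ring) a_inv_subring:
  assumes H: "subring H R" and h: "h \<in> H"
  shows "\<ominus>\<^bsub>R\<lparr>carrier := H\<rparr>\<^esub> h = \<ominus> h"
proof -
  interpret H: ring "R\<lparr>carrier := H\<rparr>" by (rule subring_is_ring[OF H])
  have "h \<in> carrier R" using h subringE(1)[OF H] by blast
  then show ?thesis using h subringE(5)[OF H] by (intro H.minus_equality) (auto simp: l_neg)
qed

text \<open>An ideal \<open>P\<close> maximal among those containing \<open>I\<close> and missing
  \<open>W\<close> is prime: if \<open>a\<close> and \<open>b\<close> lay outside \<open>P\<close>,
  then \<open>P + (a)\<close> and \<open>P + (b)\<close> would both meet \<open>W\<close>, and the
  product of the two meeting elements would lie in \<open>P\<close> as soon as
  \<open>a \<otimes> b\<close> does.\<close>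

lemma (in cring) exists_prime_disjoint_submonoid:
  assumes I: "ideal I R" and W: "submonoid W R" and disj: "I \<inter> W = {}"
  shows "\<exists>P. primeideal P R \<and> I \<subseteq> P \<and> P \<inter> W = {}"
proof -
  let ?F = "{J. ideal J R \<and> I \<subseteq> J \<and> J \<inter> W = {}}"
  have "\<exists>P\<in>?F. \<forall>J\<in>?F. P \<subseteq> J \<longrightarrow> J = P"
  proof (rule subset_Zorn_nonempty)
    show "?F \<noteq> {}" using I disj by auto
    fix C assume C: "C \<noteq> {}" "subset.chain ?F C"
    then have "subset.chain {I. ideal I R} C"
      unfolding pred_on.chain_def by auto
    then have "ideal (\<Union>C) R" using chain_Union_is_ideal C(1) by presburger
    then show "\<Union>C \<in> ?F" using C unfolding pred_on.chain_def by blast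
  qed
  then obtain P where P: "ideal P R" "I \<subseteq> P" "P \<inter> W = {}"
    and Pmax: "\<And>J. ideal J R \<Longrightarrow> P \<subseteq> J \<Longrightarrow> J \<inter> W = {} \<Longrightarrow> J = P"
    by (smt (verit, best) mem_Collect_eq subset_trans)
  interpret P: ideal P R by fact
  have Wc: "w \<in> carrier R" if "w \<in> W" for w
    using submonoid.mem_carrier[OF W that] .
  have meet: "\<exists>w\<in>W. \<exists>p\<in>P. \<exists>r\<in>carrier R. w = p \<oplus> r \<otimes> a"
    if a: "a \<in> carrier R" "a \<notin> P" for a
  proof -
    let ?J = "P <+>\<^bsub>R\<^esub> PIdl a"
    have J: "ideal ?J R" using add_ideals[OF P(1) cgenideal_ideal[OF a(1)]] .
    have mem: "x \<in> ?J \<longleftrightarrow> (\<exists>p\<in>P. \<exists>r\<in>carrier R. x = p \<oplus> r \<otimes> a)" for x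
      unfolding set_add_def' cgenideal_def by auto
    have "P \<subseteq> ?J"
    proof
      fix p assume "p \<in> P"
      moreover from this have "p = p \<oplus> \<zero> \<otimes> a" using a P.Icarr by simp
      ultimately show "p \<in> ?J" unfolding mem by blast
    qed
    moreover have "a \<in> ?J"
    proof -
      have "a = \<zero> \<oplus> \<one> \<otimes> a" using a by simp
      then show ?thesis unfolding mem using P.zero_closed by blast
    qed
    ultimately have "?J \<inter> W \<noteq> {}" using Pmax[OF J] a(2) by auto
    then show ?thesis using mem by blast
  qed
  have "primeideal P R"
  proof (rule primeidealI[OF P(1) is_cring])
    show "carrier R \<noteq> P" using P(3) submonoid.one_closed[OF W] by auto
    fix a b assume ab: "a \<in> carrier R" "b \<in> carrier R" "a \<otimes> b \<in> P"
    show "a \<in> P \<or> b \<in> P"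
    proof (rule ccontr)
      assume "\<not> (a \<in> P \<or> b \<in> P)"
      then obtain v p r w q s where
        v: "v \<in> W" "p \<in> P" "r \<in> carrier R" "v = p \<oplus> r \<otimes> a" and
        w: "w \<in> W" "q \<in> P" "s \<in> carrier R" "w = q \<oplus> s \<otimes> b"
        using meet[of a] meet[of b] ab by auto
      have pq: "p \<in> carrier R" "q \<in> carrier R" using v w P.Icarr by auto
      have "v \<otimes> w = (p \<otimes> w \<oplus> (r \<otimes> a) \<otimes> q) \<oplus> (r \<otimes> s) \<otimes> (a \<otimes> b)"
        unfolding v(4) w(4) using ab v(3) w(3) pq by algebra
      also have "\<dots> \<in> P"
        using P.I_r_closed[OF v(2) Wc[OF w(1)]] P.I_l_closed[OF w(2), of "r \<otimes> a"]
          P.I_l_closed[OF ab(3), of "r \<otimes> s"] ab v(3) w(3) P.a_closed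
        by auto
      finally show False using P(3) submonoid.m_closed[OF W v(1) w(1)] by blast
    qed
  qed
  then show ?thesis using P by blast
qed

text \<open>Elements of a simple extension arise in Horner form, starting from
  \<open>\<zero>\<close> and passing from \<open>k1\<close> to
  \<open>k1 \<otimes> x \<oplus> k2\<close>, so the closure properties come by induction along this
  form.\<close>

lemma (in cring) simple_extension_is_subring:
  assumes K: "subring K R" and x: "x \<in> carrier R"
  shows "subring (simple_extension K x) R"
proof (rule subringI)
  note Kc = subsetD[OF subringE(1)[OF K]]
  show inc: "simple_extension K x \<subseteq> carrier R"
    using simple_extension_in_carrier[OF subringE(1)[OF K] x] .
  note Ec = subsetD[OF inc]
  show "\<one> \<in> simple_extension K x"
    using simple_extension_incl[OF subringE(1)[OF K] x] subringE(3)[OF K] by auto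
  show add: "a \<oplus> b \<in> simple_extension K x"
    if "a \<in> simple_extension K x" "b \<in> simple_extension K x" for a b
    using that
  proof (induction a arbitrary: b rule: simple_extension.induct)
    case zero
    then show ?case using Ec by simp
  next
    case (lin k1 k2)
    show ?case
    using \<open>b \<in> simple_extension K x\<close>
    proof (cases rule: simple_extension.cases)
      case zero
      have "k1 \<otimes> x \<oplus> k2 \<oplus> \<zero> = k1 \<otimes> x \<oplus> k2" using lin Ec Kc x by simp
      then show ?thesis using simple_extension.lin lin zero by metis
    next
      case (lin l1 l2)
      have "k1 \<otimes> x \<oplus> k2 \<oplus> (l1 \<otimes> x \<oplus> l2) = (k1 \<oplus> l1) \<otimes> x \<oplus> (k2 \<oplus> l2)"
        using lin \<open>k1 \<in> _\<close> \<open>k2 \<in> K\<close> Ec[of k1] Ec[of l1] Kc[of k2] Kc[of l2] x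
        by algebra
      then show ?thesis
        using simple_extension.lin lin \<open>k2 \<in> K\<close> subringE(7)[OF K]
          \<open>\<And>b. b \<in> simple_extension K x \<Longrightarrow> k1 \<oplus> b \<in> simple_extension K x\<close>
        by auto
    qed
  qed
  \<comment> \<open>Used twice below: negation is scaling by \<open>\<ominus> \<one>\<close>, and a
    product splits off the multiple \<open>k2 \<otimes> b\<close> given by the constant
    term.\<close>
  have scal: "r \<otimes> a \<in> simple_extension K x"
    if "a \<in> simple_extension K x" "r \<in> K" for r a
    using that
  proof (induction a rule: simple_extension.induct)
    case zero
    then show ?case using Kc by simp
  next
    case (lin k1 k2)
    have "r \<otimes> (k1 \<otimes> x \<oplus> k2) = (r \<otimes> k1) \<otimes> x \<oplus> r \<otimes> k2"
      using lin Ec[of k1] Kc[of k2] Kc[of r] x by algebra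
    then show ?case
      using simple_extension.lin lin subringE(6)[OF K] by auto
  qed
  show "\<ominus> a \<in> simple_extension K x" if "a \<in> simple_extension K x" for a
    using scal[OF that, of "\<ominus> \<one>"] subringE(3,5)[OF K] Ec[OF that] by (simp add: l_minus)
  show "a \<otimes> b \<in> simple_extension K x"
    if "a \<in> simple_extension K x" "b \<in> simple_extension K x" for a b
    using that
  proof (induction a rule: simple_extension.induct)
    case zero
    then show ?case using Ec by simp
  next
    case (lin k1 k2)
    have "(k1 \<otimes> x \<oplus> k2) \<otimes> b = ((k1 \<otimes> b) \<otimes> x \<oplus> \<zero>) \<oplus> k2 \<otimes> b"
      using lin Ec[of k1] Kc[of k2] Ec[of b] x by algebra
    then show ?case
      using simple_extension.lin[of "k1 \<otimes> b" K x \<zero>] lin add scal subringE(2)[OF K] by auto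
  qed
qed


subsection \<open>Localization and saturation\<close>

locale localization = cring A + submonoid T A for A (structure) and T
begin

text \<open>A fraction is the image of one pair under \<open>loc_rel\<close>, so this amounts to
  \<open>loc_rel\<close> being an equivalence relation on the pairs.\<close>

lemma frac_eq_iff:
  assumes "a \<in> carrier A" "s \<in> T" "b \<in> carrier A" "t \<in> T"
  shows "frac A T a s = frac A T b t \<longleftrightarrow> (\<exists>u\<in>T. u \<otimes> (t \<otimes> a \<ominus> s \<otimes> b) = \<zero>)"
proof -
  have mem: "(b, t) \<in> frac A T a s \<longleftrightarrow>
      a \<in> carrier A \<and> s \<in> T \<and> b \<in> carrier A \<and> t \<in> T \<and> (\<exists>u\<in>T. u \<otimes> (t \<otimes> a \<ominus> s \<otimes> b) = \<zero>)"
    for a s b t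
    unfolding frac_def loc_rel_def by auto
  have refl: "(a, s) \<in> frac A T a s" if "a \<in> carrier A" "s \<in> T" for a s
  proof -
    have "\<one> \<otimes> (s \<otimes> a \<ominus> s \<otimes> a) = \<zero>" using that by simp
    then show ?thesis unfolding mem using that one_closed by blast
  qed
  have sym: "(a, s) \<in> frac A T b t" if h: "(b, t) \<in> frac A T a s" for a s b t
  proof -
    obtain u where u: "u \<in> T" "u \<otimes> (t \<otimes> a \<ominus> s \<otimes> b) = \<zero>" using h mem by blast
    have c: "a \<in> carrier A" "s \<in> T" "b \<in> carrier A" "t \<in> T" using h mem by auto
    have "u \<otimes> (s \<otimes> b \<ominus> t \<otimes> a) = \<ominus> (u \<otimes> (t \<otimes> a \<ominus> s \<otimes> b))"
      using u(1) c mem_carrier by algebra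
    then show ?thesis unfolding mem using u c by auto
  qed
  have trans: "(c, r) \<in> frac A T a s"
    if h: "(b, t) \<in> frac A T a s" "(c, r) \<in> frac A T b t" for a s b t c r
  proof -
    obtain u where u: "u \<in> T" "u \<otimes> (t \<otimes> a \<ominus> s \<otimes> b) = \<zero>" using h mem by blast
    obtain v where v: "v \<in> T" "v \<otimes> (r \<otimes> b \<ominus> t \<otimes> c) = \<zero>" using h mem by blast
    have c: "a \<in> carrier A" "s \<in> T" "b \<in> carrier A" "t \<in> T" "c \<in> carrier A" "r \<in> T"
      using h mem by auto
    have d: "u \<in> carrier A" "v \<in> carrier A" "s \<in> carrier A" "t \<in> carrier A" "r \<in> carrier A"
      using u v c mem_carrier by auto
    \<comment> \<open>Multiplying by the middle denominator \<open>t\<close> as well turns the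
      difference into a combination of the two vanishing terms.\<close>
    have "(u \<otimes> v \<otimes> t) \<otimes> (r \<otimes> a \<ominus> s \<otimes> c) =
        (v \<otimes> r) \<otimes> (u \<otimes> (t \<otimes> a \<ominus> s \<otimes> b)) \<oplus> (u \<otimes> s) \<otimes> (v \<otimes> (r \<otimes> b \<ominus> t \<otimes> c))"
      using c(1,3,5) d by algebra
    also have "\<dots> = \<zero>" unfolding u(2) v(2) using d by simp
    finally show ?thesis unfolding mem using c u(1) v(1) m_closed by blast
  qed
  have "frac A T a s = frac A T b t \<longleftrightarrow> (b, t) \<in> frac A T a s"
  proof
    assume "frac A T a s = frac A T b t"
    then show "(b, t) \<in> frac A T a s" using refl[OF assms(3,4)] by simp
  next
    assume h: "(b, t) \<in> frac A T a s"
    have "(c, r) \<in> frac A T a s \<longleftrightarrow> (c, r) \<in> frac A T b t" for c r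
      using trans[OF h] trans[OF sym[OF h]] by blast
    then show "frac A T a s = frac A T b t" by auto
  qed
  then show ?thesis unfolding mem using assms by simp
qed

lemma frac_eqI:
  assumes "a \<in> carrier A" "s \<in> T" "b \<in> carrier A" "t \<in> T" "t \<otimes> a = s \<otimes> b"
  shows "frac A T a s = frac A T b t"
proof -
  have "\<one> \<otimes> (t \<otimes> a \<ominus> s \<otimes> b) = \<zero>" using assms by simp
  then show ?thesis using frac_eq_iff[OF assms(1-4)] one_closed by blast
qed

lemma mem_frac_iff:
  assumes "a \<in> carrier A" "s \<in> T"
  shows "(b, t) \<in> frac A T a s \<longleftrightarrow> b \<in> carrier A \<and> t \<in> T \<and> frac A T b t = frac A T a s"
proof (cases "b \<in> carrier A \<and> t \<in> T")
  case True
  then have "(b, t) \<in> frac A T a s \<longleftrightarrow> frac A T a s = frac A T b t"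
    using frac_eq_iff[OF assms, of b t] assms by (simp, simp add: frac_def loc_rel_def)
  then show ?thesis using True by auto
qed (auto simp: frac_def loc_rel_def)

lemma carrier_ring_loc:
  "carrier (ring_loc A T) = {frac A T a s | a s. a \<in> carrier A \<and> s \<in> T}"
proof -
  have "carrier (ring_loc A T) = (\<Union>x\<in>carrier A \<times> T. {frac A T (fst x) (snd x)})"
    by (simp add: ring_loc_def quotient_def frac_def)
  then show ?thesis by force
qed

lemma frac_closed [intro, simp]:
  "a \<in> carrier A \<Longrightarrow> s \<in> T \<Longrightarrow> frac A T a s \<in> carrier (ring_loc A T)"
  unfolding carrier_ring_loc by blast

lemma frac_cases:
  assumes "x \<in> carrier (ring_loc A T)"
  obtains a s where "a \<in> carrier A" "s \<in> T" "x = frac A T a s"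
  using assms unfolding carrier_ring_loc by blast

text \<open>The operations of \<open>ring_loc\<close> and the map \<open>loc_incl\<close> are unions
  over all representatives. Once the term is independent of the representative, the union collapses
  to its single value; well-definedness is reduced to this.\<close>

lemma Union_frac:
  assumes "a \<in> carrier A" "s \<in> T"
    and "\<And>b t. b \<in> carrier A \<Longrightarrow> t \<in> T \<Longrightarrow> frac A T b t = frac A T a s \<Longrightarrow> f b t = C"
  shows "(\<Union>(b, t)\<in>frac A T a s. f b t) = C"
proof -
  have "f b t = C" if "(b, t) \<in> frac A T a s" for b t
    using that assms(3) mem_frac_iff[OF assms(1,2)] by simp
  then have "case_prod f x = C" if "x \<in> frac A T a s" for x
    using that by (cases x) simp
  moreover have "frac A T a s \<noteq> {}" using mem_frac_iff[OF assms(1,2), of a s] assms(1,2) by auto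
  ultimately show ?thesis by simp
qed

lemma frac_mult:
  assumes "a \<in> carrier A" "s \<in> T" "b \<in> carrier A" "t \<in> T"
  shows "frac A T a s \<otimes>\<^bsub>ring_loc A T\<^esub> frac A T b t = frac A T (a \<otimes> b) (s \<otimes> t)"
proof -
  have rep: "frac A T (a' \<otimes> b') (s' \<otimes> t') = frac A T (a \<otimes> b) (s \<otimes> t)"
    if c: "a' \<in> carrier A" "s' \<in> T" "b' \<in> carrier A" "t' \<in> T"
      and e: "frac A T a' s' = frac A T a s" "frac A T b' t' = frac A T b t" for a' s' b' t'
  proof -
    obtain u where u: "u \<in> T" "u \<otimes> (s \<otimes> a' \<ominus> s' \<otimes> a) = \<zero>"
      using e(1) frac_eq_iff[OF c(1,2) assms(1,2)] by blast
    obtain v where v: "v \<in> T" "v \<otimes> (t \<otimes> b' \<ominus> t' \<otimes> b) = \<zero>"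
      using e(2) frac_eq_iff[OF c(3,4) assms(3,4)] by blast
    have d: "u \<in> carrier A" "v \<in> carrier A" "s \<in> carrier A" "t \<in> carrier A"
      "s' \<in> carrier A" "t' \<in> carrier A"
      using u v c assms mem_carrier by auto
    \<comment> \<open>The difference telescopes through a mixed product, so that each part contains
      one of the two vanishing differences.\<close>
    have "(u \<otimes> v) \<otimes> ((s \<otimes> t) \<otimes> (a' \<otimes> b') \<ominus> (s' \<otimes> t') \<otimes> (a \<otimes> b)) =
        (v \<otimes> t \<otimes> b') \<otimes> (u \<otimes> (s \<otimes> a' \<ominus> s' \<otimes> a)) \<oplus>
        (u \<otimes> s' \<otimes> a) \<otimes> (v \<otimes> (t \<otimes> b' \<ominus> t' \<otimes> b))"
      using c(1,3) assms(1,3) d by algebra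
    also have "\<dots> = \<zero>" unfolding u(2) v(2) using c assms d by simp
    finally have "\<exists>w\<in>T. w \<otimes> ((s \<otimes> t) \<otimes> (a' \<otimes> b') \<ominus> (s' \<otimes> t') \<otimes> (a \<otimes> b)) = \<zero>"
      using submonoid.m_closed[OF submonoid_axioms u(1) v(1)] by blast
    then show ?thesis
      using frac_eq_iff[of "a' \<otimes> b'" "s' \<otimes> t'" "a \<otimes> b" "s \<otimes> t"] c assms by simp
  qed
  have "(\<Union>(a', s')\<in>frac A T a s. \<Union>(b', t')\<in>frac A T b t.
      frac A T (a' \<otimes> b') (s' \<otimes> t')) = frac A T (a \<otimes> b) (s \<otimes> t)"
    by (rule Union_frac[OF assms(1,2)], rule Union_frac[OF assms(3,4)], rule rep)
  then show ?thesis by (simp add: ring_loc_def)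
qed

lemma frac_add:
  assumes "a \<in> carrier A" "s \<in> T" "b \<in> carrier A" "t \<in> T"
  shows "frac A T a s \<oplus>\<^bsub>ring_loc A T\<^esub> frac A T b t = frac A T (t \<otimes> a \<oplus> s \<otimes> b) (s \<otimes> t)"
proof -
  have rep: "frac A T (t' \<otimes> a' \<oplus> s' \<otimes> b') (s' \<otimes> t') = frac A T (t \<otimes> a \<oplus> s \<otimes> b) (s \<otimes> t)"
    if c: "a' \<in> carrier A" "s' \<in> T" "b' \<in> carrier A" "t' \<in> T"
      and e: "frac A T a' s' = frac A T a s" "frac A T b' t' = frac A T b t" for a' s' b' t'
  proof -
    obtain u where u: "u \<in> T" "u \<otimes> (s \<otimes> a' \<ominus> s' \<otimes> a) = \<zero>"
      using e(1) frac_eq_iff[OF c(1,2) assms(1,2)] by blast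
    obtain v where v: "v \<in> T" "v \<otimes> (t \<otimes> b' \<ominus> t' \<otimes> b) = \<zero>"
      using e(2) frac_eq_iff[OF c(3,4) assms(3,4)] by blast
    have d: "u \<in> carrier A" "v \<in> carrier A" "s \<in> carrier A" "t \<in> carrier A"
      "s' \<in> carrier A" "t' \<in> carrier A"
      using u v c assms mem_carrier by auto
    have "(u \<otimes> v) \<otimes> ((s \<otimes> t) \<otimes> (t' \<otimes> a' \<oplus> s' \<otimes> b') \<ominus> (s' \<otimes> t') \<otimes> (t \<otimes> a \<oplus> s \<otimes> b)) =
        (v \<otimes> t \<otimes> t') \<otimes> (u \<otimes> (s \<otimes> a' \<ominus> s' \<otimes> a)) \<oplus>
        (u \<otimes> s \<otimes> s') \<otimes> (v \<otimes> (t \<otimes> b' \<ominus> t' \<otimes> b))"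
      using c(1,3) assms(1,3) d by algebra
    also have "\<dots> = \<zero>" unfolding u(2) v(2) using c assms d by simp
    finally have "\<exists>w\<in>T. w \<otimes> ((s \<otimes> t) \<otimes> (t' \<otimes> a' \<oplus> s' \<otimes> b')
        \<ominus> (s' \<otimes> t') \<otimes> (t \<otimes> a \<oplus> s \<otimes> b)) = \<zero>"
      using submonoid.m_closed[OF submonoid_axioms u(1) v(1)] by blast
    then show ?thesis
      using frac_eq_iff[of "t' \<otimes> a' \<oplus> s' \<otimes> b'" "s' \<otimes> t'" "t \<otimes> a \<oplus> s \<otimes> b" "s \<otimes> t"] c assms
      by simp
  qed
  have "(\<Union>(a', s')\<in>frac A T a s. \<Union>(b', t')\<in>frac A T b t.
      frac A T (t' \<otimes> a' \<oplus> s' \<otimes> b') (s' \<otimes> t')) = frac A T (t \<otimes> a \<oplus> s \<otimes> b) (s \<otimes> t)"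
    by (rule Union_frac[OF assms(1,2)], rule Union_frac[OF assms(3,4)], rule rep)
  then show ?thesis by (simp add: ring_loc_def)
qed

lemma one_ring_loc: "\<one>\<^bsub>ring_loc A T\<^esub> = frac A T \<one> \<one>"
  and zero_ring_loc: "\<zero>\<^bsub>ring_loc A T\<^esub> = frac A T \<zero> \<one>"
  by (simp_all add: ring_loc_def)

lemma frac_l_neg:
  assumes "a \<in> carrier A" "s \<in> T"
  shows "frac A T (\<ominus> a) s \<oplus>\<^bsub>ring_loc A T\<^esub> frac A T a s = \<zero>\<^bsub>ring_loc A T\<^esub>"
proof -
  have "frac A T (\<ominus> a) s \<oplus>\<^bsub>ring_loc A T\<^esub> frac A T a s = frac A T \<zero> (s \<otimes> s)"
    using assms by (simp add: frac_add l_neg flip: r_distr)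
  also have "\<dots> = \<zero>\<^bsub>ring_loc A T\<^esub>"
    unfolding zero_ring_loc using assms by (intro frac_eqI) auto
  finally show ?thesis .
qed

lemma cring_ring_loc: "cring (ring_loc A T)"
proof (rule cringI)
  show "abelian_group (ring_loc A T)"
  proof (rule abelian_groupI)
    fix x assume "x \<in> carrier (ring_loc A T)"
    then obtain a s where x: "a \<in> carrier A" "s \<in> T" "x = frac A T a s" by (rule frac_cases)
    show "\<zero>\<^bsub>ring_loc A T\<^esub> \<oplus>\<^bsub>ring_loc A T\<^esub> x = x"
      using x by (simp add: zero_ring_loc frac_add)
    show "\<exists>y\<in>carrier (ring_loc A T). y \<oplus>\<^bsub>ring_loc A T\<^esub> x = \<zero>\<^bsub>ring_loc A T\<^esub>"
      using frac_l_neg[OF x(1,2)] x by (intro bexI[of _ "frac A T (\<ominus> a) s"]) auto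
    fix y assume "y \<in> carrier (ring_loc A T)"
    then obtain b t where y: "b \<in> carrier A" "t \<in> T" "y = frac A T b t" by (rule frac_cases)
    show "x \<oplus>\<^bsub>ring_loc A T\<^esub> y \<in> carrier (ring_loc A T)"
      using x y by (simp add: frac_add)
    show "x \<oplus>\<^bsub>ring_loc A T\<^esub> y = y \<oplus>\<^bsub>ring_loc A T\<^esub> x"
      using x y by (simp add: frac_add m_comm a_comm)
    fix z assume "z \<in> carrier (ring_loc A T)"
    then obtain c r where z: "c \<in> carrier A" "r \<in> T" "z = frac A T c r" by (rule frac_cases)
    have d: "s \<in> carrier A" "t \<in> carrier A" "r \<in> carrier A" using x y z mem_carrier by auto
    have "r \<otimes> (t \<otimes> a \<oplus> s \<otimes> b) \<oplus> s \<otimes> t \<otimes> c = t \<otimes> r \<otimes> a \<oplus> s \<otimes> (r \<otimes> b \<oplus> t \<otimes> c)"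
      using x(1) y(1) z(1) d by algebra
    then show "x \<oplus>\<^bsub>ring_loc A T\<^esub> y \<oplus>\<^bsub>ring_loc A T\<^esub> z = x \<oplus>\<^bsub>ring_loc A T\<^esub> (y \<oplus>\<^bsub>ring_loc A T\<^esub> z)"
      using x y z d by (simp add: frac_add m_assoc)
  next
    show "\<zero>\<^bsub>ring_loc A T\<^esub> \<in> carrier (ring_loc A T)" by (simp add: zero_ring_loc)
  qed
  show "comm_monoid (ring_loc A T)"
  proof (rule comm_monoidI)
    show "\<one>\<^bsub>ring_loc A T\<^esub> \<in> carrier (ring_loc A T)" by (simp add: one_ring_loc)
    fix x assume "x \<in> carrier (ring_loc A T)"
    then obtain a s where x: "a \<in> carrier A" "s \<in> T" "x = frac A T a s" by (rule frac_cases)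
    show "\<one>\<^bsub>ring_loc A T\<^esub> \<otimes>\<^bsub>ring_loc A T\<^esub> x = x"
      using x by (simp add: one_ring_loc frac_mult)
    fix y assume "y \<in> carrier (ring_loc A T)"
    then obtain b t where y: "b \<in> carrier A" "t \<in> T" "y = frac A T b t" by (rule frac_cases)
    show "x \<otimes>\<^bsub>ring_loc A T\<^esub> y \<in> carrier (ring_loc A T)"
      using x y by (simp add: frac_mult)
    show "x \<otimes>\<^bsub>ring_loc A T\<^esub> y = y \<otimes>\<^bsub>ring_loc A T\<^esub> x"
      using x y by (simp add: frac_mult m_comm)
    fix z assume "z \<in> carrier (ring_loc A T)"
    then obtain c r where z: "c \<in> carrier A" "r \<in> T" "z = frac A T c r" by (rule frac_cases)
    show "x \<otimes>\<^bsub>ring_loc A T\<^esub> y \<otimes>\<^bsub>ring_loc A T\<^esub> z = x \<otimes>\<^bsub>ring_loc A T\<^esub> (y \<otimes>\<^bsub>ring_loc A T\<^esub> z)"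
      using x y z by (simp add: frac_mult m_assoc)
  qed
  fix x y z
  assume "x \<in> carrier (ring_loc A T)" "y \<in> carrier (ring_loc A T)" "z \<in> carrier (ring_loc A T)"
  then obtain a s b t c r where x: "a \<in> carrier A" "s \<in> T" "x = frac A T a s"
    and y: "b \<in> carrier A" "t \<in> T" "y = frac A T b t"
    and z: "c \<in> carrier A" "r \<in> T" "z = frac A T c r"
    by (metis frac_cases)
  have d: "s \<in> carrier A" "t \<in> carrier A" "r \<in> carrier A" using x y z mem_carrier by auto
  \<comment> \<open>In the distributive law the denominators differ by a factor \<open>r\<close>, so
    the two sides agree only as fractions and not as pairs.\<close>
  have "frac A T ((t \<otimes> a \<oplus> s \<otimes> b) \<otimes> c) (s \<otimes> t \<otimes> r) =
      frac A T (t \<otimes> r \<otimes> (a \<otimes> c) \<oplus> s \<otimes> r \<otimes> (b \<otimes> c)) (s \<otimes> r \<otimes> (t \<otimes> r))"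
  proof (rule frac_eqI)
    show "s \<otimes> r \<otimes> (t \<otimes> r) \<otimes> ((t \<otimes> a \<oplus> s \<otimes> b) \<otimes> c) =
        s \<otimes> t \<otimes> r \<otimes> (t \<otimes> r \<otimes> (a \<otimes> c) \<oplus> s \<otimes> r \<otimes> (b \<otimes> c))"
      using x(1) y(1) z(1) d by algebra
  qed (use x y z in auto)
  then show "(x \<oplus>\<^bsub>ring_loc A T\<^esub> y) \<otimes>\<^bsub>ring_loc A T\<^esub> z =
      x \<otimes>\<^bsub>ring_loc A T\<^esub> z \<oplus>\<^bsub>ring_loc A T\<^esub> y \<otimes>\<^bsub>ring_loc A T\<^esub> z"
    using x y z by (simp add: frac_mult frac_add)
qed

lemma frac_minus:
  assumes "a \<in> carrier A" "s \<in> T"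
  shows "\<ominus>\<^bsub>ring_loc A T\<^esub> frac A T a s = frac A T (\<ominus> a) s"
proof -
  interpret L: cring "ring_loc A T" by (rule cring_ring_loc)
  show ?thesis
    using assms frac_l_neg by (intro L.minus_equality) auto
qed

end

section \<open>Saturated intermediate rings and the intermediate rings of the localization\<close>

definition saturation :: "('a, 'b) ring_scheme \<Rightarrow> 'a set \<Rightarrow> 'a set \<Rightarrow> 'a set"
  where "saturation A T B = {a \<in> carrier A. \<exists>u\<in>T. u \<otimes>\<^bsub>A\<^esub> a \<in> B}"

text \<open>All denominators lie in the base \<open>R\<close>, hence in every intermediate ring,
  which keeps saturations and sets of fractions closed under the ring operations.\<close>

locale subring_localization = localization S T for S (structure) and T +
  fixes R
  assumes R_subring: "subring R S" and T_sub: "T \<subseteq> R"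
begin

abbreviation sat :: "'a set \<Rightarrow> 'a set" where "sat \<equiv> saturation S T"

lemma subset_sat: "B \<subseteq> carrier S \<Longrightarrow> B \<subseteq> sat B"
  unfolding saturation_def using one_closed by (auto 0 4 intro!: bexI[of _ \<one>])

lemma sat_sat:
  assumes "B \<subseteq> carrier S"
  shows "sat (sat B) = sat B"
proof
  show "sat (sat B) \<subseteq> sat B"
  proof
    fix s assume "s \<in> sat (sat B)"
    then obtain u v where "s \<in> carrier S" "u \<in> T" "v \<in> T" "v \<otimes> (u \<otimes> s) \<in> B"
      unfolding saturation_def by blast
    moreover from this have "(v \<otimes> u) \<otimes> s \<in> B" by (simp add: m_assoc)
    ultimately show "s \<in> sat B" unfolding saturation_def
      using submonoid.m_closed[OF submonoid_axioms] by blast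
  qed
  show "sat B \<subseteq> sat (sat B)" by (rule subset_sat) (auto simp: saturation_def)
qed

text \<open>The product \<open>u \<otimes> v\<close> of multipliers for \<open>a\<close> and
  \<open>b\<close> serves both \<open>a \<oplus> b\<close> and \<open>a \<otimes> b\<close>; in the
  sum, \<open>u\<close> and \<open>v\<close> appear as coefficients and belong to \<open>B\<close>
  because \<open>T \<subseteq> R \<subseteq> B\<close>.\<close>

lemma sat_subring:
  assumes B: "subring B S" "R \<subseteq> B"
  shows "subring (sat B) S"
proof (rule subringI)
  note Xc = subsetD[OF subringE(1)[OF B(1)]]
  show "sat B \<subseteq> carrier S" unfolding saturation_def by blast
  show "\<one> \<in> sat B" using subset_sat[OF subringE(1)[OF B(1)]] subringE(3)[OF B(1)] by blast
  fix a assume "a \<in> sat B"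
  then obtain u where a: "a \<in> carrier S" "u \<in> T" "u \<otimes> a \<in> B" unfolding saturation_def by blast
  have uX: "u \<in> B" using a T_sub B by blast
  have "u \<otimes> \<ominus> a = \<ominus> (u \<otimes> a)" using a by (simp add: r_minus)
  then have "u \<otimes> \<ominus> a \<in> B" using subringE(5)[OF B(1) a(3)] by simp
  then show "\<ominus> a \<in> sat B" unfolding saturation_def using a by blast
  fix b assume "b \<in> sat B"
  then obtain v where b: "b \<in> carrier S" "v \<in> T" "v \<otimes> b \<in> B" unfolding saturation_def by blast
  have vX: "v \<in> B" using b T_sub B by blast
  have c: "u \<in> carrier S" "v \<in> carrier S" using a b by auto
  have uv: "u \<otimes> v \<in> T" using a b by blast
  have "(u \<otimes> v) \<otimes> (a \<otimes> b) = (u \<otimes> a) \<otimes> (v \<otimes> b)" using a(1) b(1) c by algebra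
  then have "(u \<otimes> v) \<otimes> (a \<otimes> b) \<in> B" using subringE(6)[OF B(1) a(3) b(3)] by simp
  then show "a \<otimes> b \<in> sat B" unfolding saturation_def using a b uv by blast
  have "(u \<otimes> v) \<otimes> (a \<oplus> b) = v \<otimes> (u \<otimes> a) \<oplus> u \<otimes> (v \<otimes> b)" using a(1) b(1) c by algebra
  then have "(u \<otimes> v) \<otimes> (a \<oplus> b) \<in> B"
    using subringE(7)[OF B(1) subringE(6)[OF B(1) vX a(3)] subringE(6)[OF B(1) uX b(3)]] by simp
  then show "a \<oplus> b \<in> sat B" unfolding saturation_def using a b uv by blast
qed

text \<open>This is the localization of \<open>B\<close> formed inside that of \<open>S\<close>, so
  that the localizations of different \<open>B\<close> can be compared as sets.\<close>

definition fracs :: "'a set \<Rightarrow> ('a \<times> 'a) set set"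
  where "fracs B = {frac S T x t | x t. x \<in> B \<and> t \<in> T}"

lemma fracs_carrier: "fracs (carrier S) = carrier (ring_loc S T)"
  unfolding fracs_def carrier_ring_loc ..

text \<open>Clearing denominators in an equality with a fraction over \<open>B\<close> moves a
  multiple of \<open>a\<close> into \<open>B\<close>; conversely, the fraction may be expanded by a
  multiplier of \<open>a\<close>. With \<open>s = \<one>\<close>, the saturation is the preimage of
  \<open>fracs B\<close> in \<open>S\<close>.\<close>

lemma frac_mem_fracs_iff:
  assumes B: "subring B S" "R \<subseteq> B" and "a \<in> carrier S" "s \<in> T"
  shows "frac S T a s \<in> fracs B \<longleftrightarrow> a \<in> sat B"
proof
  note Xc = subsetD[OF subringE(1)[OF B(1)]]
  have TX: "t \<in> B" if "t \<in> T" for t using that T_sub B by blast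
  have sc: "s \<in> carrier S" using assms by simp
  {
    assume "frac S T a s \<in> fracs B"
    then obtain x t where x: "x \<in> B" "t \<in> T" "frac S T a s = frac S T x t"
      unfolding fracs_def by blast
    then obtain u where u: "u \<in> T" "u \<otimes> (t \<otimes> a \<ominus> s \<otimes> x) = \<zero>"
      using frac_eq_iff[OF assms(3,4) Xc[OF x(1)] x(2)] by blast
    have c: "u \<in> carrier S" "t \<in> carrier S" "x \<in> carrier S" using u x Xc by auto
    have "(u \<otimes> t) \<otimes> a = u \<otimes> (t \<otimes> a \<ominus> s \<otimes> x) \<oplus> u \<otimes> (s \<otimes> x)"
      using assms(3) sc c by algebra
    also have "\<dots> = u \<otimes> (s \<otimes> x)" unfolding u(2) using sc c by simp
    also have "\<dots> \<in> B" using subringE(6)[OF B(1)] TX u x assms(4) by simp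
    finally show "a \<in> sat B" unfolding saturation_def
      using assms(3) submonoid.m_closed[OF submonoid_axioms u(1) x(2)] by blast
  }
  {
    assume "a \<in> sat B"
    then obtain u where u: "u \<in> T" "u \<otimes> a \<in> B" unfolding saturation_def by blast
    have "frac S T a s = frac S T (u \<otimes> a) (u \<otimes> s)"
      using u assms(3,4) sc by (intro frac_eqI) (auto simp: m_ac)
    then show "frac S T a s \<in> fracs B" unfolding fracs_def
      using u submonoid.m_closed[OF submonoid_axioms u(1) assms(4)] by blast
  }
qed

lemma fracs_subring:
  assumes B: "subring B S" "R \<subseteq> B"
  shows "subring (fracs B) (ring_loc S T)"
proof -
  interpret L: cring "ring_loc S T" by (rule cring_ring_loc)
  note Xc = subsetD[OF subringE(1)[OF B(1)]]
  have TX: "t \<in> B" if "t \<in> T" for t using that T_sub B by blast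
  show ?thesis
  proof (rule L.subringI)
    show "fracs B \<subseteq> carrier (ring_loc S T)"
      unfolding fracs_def carrier_ring_loc using Xc by blast
    show "\<one>\<^bsub>ring_loc S T\<^esub> \<in> fracs B"
      unfolding fracs_def one_ring_loc using subringE(3)[OF B(1)] one_closed by blast
    fix x assume "x \<in> fracs B"
    then obtain a s where x: "a \<in> B" "s \<in> T" "x = frac S T a s" unfolding fracs_def by blast
    show "\<ominus>\<^bsub>ring_loc S T\<^esub> x \<in> fracs B"
      unfolding x(3) frac_minus[OF Xc[OF x(1)] x(2)] unfolding fracs_def
      using x subringE(5)[OF B(1)] by blast
    fix y assume "y \<in> fracs B"
    then obtain b t where y: "b \<in> B" "t \<in> T" "y = frac S T b t" unfolding fracs_def by blast
    have st: "s \<otimes> t \<in> T" using x y by blast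
    show "x \<otimes>\<^bsub>ring_loc S T\<^esub> y \<in> fracs B"
      unfolding x(3) y(3) frac_mult[OF Xc[OF x(1)] x(2) Xc[OF y(1)] y(2)] unfolding fracs_def
      using subringE(6)[OF B(1) x(1) y(1)] st by blast
    have "t \<otimes> a \<oplus> s \<otimes> b \<in> B" using x y TX subringE(6,7)[OF B(1)] by simp
    then show "x \<oplus>\<^bsub>ring_loc S T\<^esub> y \<in> fracs B"
      unfolding x(3) y(3) frac_add[OF Xc[OF x(1)] x(2) Xc[OF y(1)] y(2)] unfolding fracs_def
      using st by blast
  qed
qed

lemma minus_restrict:
  assumes "a \<in> R" "b \<in> R"
  shows "a \<ominus>\<^bsub>S\<lparr>carrier := R\<rparr>\<^esub> b = a \<ominus> b"
  using assms a_inv_subring[OF R_subring] by (simp add: a_minus_def)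

lemma localization_restrict: "localization (S\<lparr>carrier := R\<rparr>) T"
proof (rule localization.intro)
  show "cring (S\<lparr>carrier := R\<rparr>)"
    by (rule subring_is_cring[OF R_subring])
  show "submonoid T (S\<lparr>carrier := R\<rparr>)"
    using T_sub by (auto intro!: submonoid.intro)
qed

text \<open>A multiplier witnessing equality of two fractions over \<open>R\<close> witnesses it
  over \<open>S\<close> too, so the union defining \<open>loc_incl\<close> collapses.\<close>

lemma loc_incl_frac:
  assumes "r \<in> R" "t \<in> T"
  shows "loc_incl S T (frac (S\<lparr>carrier := R\<rparr>) T r t) = frac S T r t"
  unfolding loc_incl_def
proof (rule localization.Union_frac[OF localization_restrict])
  interpret RL: localization "S\<lparr>carrier := R\<rparr>" T by (rule localization_restrict)
  note Rc = subsetD[OF subringE(1)[OF R_subring]]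
  fix b u assume b: "b \<in> carrier (S\<lparr>carrier := R\<rparr>)" "u \<in> T"
    "frac (S\<lparr>carrier := R\<rparr>) T b u = frac (S\<lparr>carrier := R\<rparr>) T r t"
  have "t \<otimes> b \<in> R" "u \<otimes> r \<in> R"
    using b assms T_sub subringE(6)[OF R_subring] by auto
  then have "\<exists>v\<in>T. v \<otimes> (t \<otimes> b \<ominus> u \<otimes> r) = \<zero>"
    using b RL.frac_eq_iff[of b u r t] assms by (simp add: minus_restrict)
  then show "frac S T b u = frac S T r t"
    using frac_eq_iff[of b u r t] b assms Rc by simp
qed (use assms in auto)

text \<open>Allows the base ring of \<open>base_at\<close> to be handled as \<open>fracs R\<close>,
  with all fractions taken in \<open>S\<close>.\<close>

lemma base_eq_fracs: "loc_incl S T ` carrier (ring_loc (S\<lparr>carrier := R\<rparr>) T) = fracs R"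
proof -
  interpret RL: localization "S\<lparr>carrier := R\<rparr>" T by (rule localization_restrict)
  show ?thesis
    unfolding RL.carrier_ring_loc fracs_def
  proof (rule equalityI; rule subsetI)
    fix x assume "x \<in> loc_incl S T `
      {frac (S\<lparr>carrier := R\<rparr>) T a s |a s. a \<in> carrier (S\<lparr>carrier := R\<rparr>) \<and> s \<in> T}"
    then obtain a s where "a \<in> R" "s \<in> T" "x = loc_incl S T (frac (S\<lparr>carrier := R\<rparr>) T a s)"
      by auto
    then show "x \<in> {frac S T x t |x t. x \<in> R \<and> t \<in> T}" using loc_incl_frac by auto
  next
    fix x assume "x \<in> {frac S T x t |x t. x \<in> R \<and> t \<in> T}"
    then obtain a s where "a \<in> R" "s \<in> T" "x = loc_incl S T (frac (S\<lparr>carrier := R\<rparr>) T a s)"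
      using loc_incl_frac by auto
    then show "x \<in> loc_incl S T `
      {frac (S\<lparr>carrier := R\<rparr>) T a s |a s. a \<in> carrier (S\<lparr>carrier := R\<rparr>) \<and> s \<in> T}"
      by auto
  qed
qed

text \<open>Since \<open>Y\<close> contains every element of \<open>T\<close> together with its
  inverse, membership of a fraction in \<open>Y\<close> depends on the numerator alone. Hence
  \<open>Y\<close> is recovered from its preimage \<open>B\<close>, and \<open>B\<close> is
  saturated.\<close>

lemma frac_pullback:
  assumes Y: "subring Y (ring_loc S T)" "fracs R \<subseteq> Y"
  defines "B \<equiv> {a \<in> carrier S. frac S T a \<one> \<in> Y}"
  shows "subring B S" "R \<subseteq> B" "sat B = B" "Y = fracs B"
proof -
  interpret L: cring "ring_loc S T" by (rule cring_ring_loc)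
  note Rc = subsetD[OF subringE(1)[OF R_subring]]
  have unit: "frac S T r t \<in> Y" if "r \<in> R" "t \<in> T" for r t
    using that Y(2) unfolding fracs_def by blast
  have R1: "\<one> \<in> R" using subringE(3)[OF R_subring] .
  show "R \<subseteq> B" unfolding B_def using unit Rc one_closed by blast
  \<comment> \<open>One direction multiplies by \<open>frac S T t \<one>\<close>, the other by its
    inverse \<open>frac S T \<one> t\<close>; both lie in \<open>fracs R\<close>.\<close>
  have shift: "frac S T (t \<otimes> a) s \<in> Y \<longleftrightarrow> frac S T a s \<in> Y"
    if "a \<in> carrier S" "t \<in> T" "s \<in> T" for a t s
  proof
    have tc: "t \<in> carrier S" "s \<in> carrier S" using that by auto
    have "frac S T (t \<otimes> a) s = frac S T t \<one> \<otimes>\<^bsub>ring_loc S T\<^esub> frac S T a s"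
      using that by (simp add: frac_mult)
    moreover have "frac S T t \<one> \<in> Y" using unit that T_sub by auto
    ultimately show "frac S T a s \<in> Y \<Longrightarrow> frac S T (t \<otimes> a) s \<in> Y"
      using subringE(6)[OF Y(1)] by simp
    have "frac S T a s = frac S T (\<one> \<otimes> (t \<otimes> a)) (t \<otimes> s)"
      using that tc by (intro frac_eqI) (auto simp: m_ac)
    also have "\<dots> = frac S T \<one> t \<otimes>\<^bsub>ring_loc S T\<^esub> frac S T (t \<otimes> a) s"
      using that tc by (simp add: frac_mult)
    finally show "frac S T (t \<otimes> a) s \<in> Y \<Longrightarrow> frac S T a s \<in> Y"
      using subringE(6)[OF Y(1) unit[OF R1 that(2)]] by simp
  qed
  have denom: "frac S T a s \<in> Y \<longleftrightarrow> frac S T a \<one> \<in> Y" if "a \<in> carrier S" "s \<in> T" for a s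
  proof -
    have "frac S T a \<one> = frac S T (s \<otimes> a) s"
      using that by (intro frac_eqI) auto
    then show ?thesis using shift[OF that that(2)] by simp
  qed
  show "subring B S"
  proof (rule subringI)
    show "B \<subseteq> carrier S" unfolding B_def by blast
    show "\<one> \<in> B" using \<open>R \<subseteq> B\<close> R1 by blast
    fix a assume a: "a \<in> B"
    then show "\<ominus> a \<in> B"
      unfolding B_def using subringE(5)[OF Y(1), of "frac S T a \<one>"] by (simp add: frac_minus)
    fix b assume b: "b \<in> B"
    show "a \<otimes> b \<in> B"
      using a b subringE(6)[OF Y(1), of "frac S T a \<one>" "frac S T b \<one>"]
      unfolding B_def by (simp add: frac_mult)
    show "a \<oplus> b \<in> B"
      using a b subringE(7)[OF Y(1), of "frac S T a \<one>" "frac S T b \<one>"]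
      unfolding B_def by (simp add: frac_add)
  qed
  show "sat B = B"
    unfolding saturation_def B_def using shift one_closed by (auto intro: bexI[of _ \<one>])
  show "Y = fracs B"
  proof (rule equalityI; rule subsetI)
    fix y assume y: "y \<in> Y"
    then obtain a s where "a \<in> carrier S" "s \<in> T" "y = frac S T a s"
      using subringE(1)[OF Y(1)] frac_cases by blast
    then show "y \<in> fracs B" unfolding fracs_def B_def using y denom by blast
  next
    fix y assume "y \<in> fracs B"
    then show "y \<in> Y" unfolding fracs_def B_def using denom by blast
  qed
qed

text \<open>Taking fractions and taking preimages match the saturated intermediate rings with the
  rings between \<open>fracs R\<close> and the localization; \<open>sat R\<close> corresponds to the
  base. The assumption \<open>ne\<close> makes that base proper, as a ring extension
  requires.\<close>

lemma minimal_extension_loc_iff: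
  assumes ne: "sat R \<noteq> carrier S"
  shows "minimal_extension (ring_loc S T) (fracs R) \<longleftrightarrow>
    (\<forall>B. subring B S \<and> R \<subseteq> B \<and> sat B = B \<longrightarrow> B = sat R \<or> B = carrier S)"
    (is "_ \<longleftrightarrow> ?rhs")
proof -
  interpret L: cring "ring_loc S T" by (rule cring_ring_loc)
  note fracs_R = fracs_subring[OF R_subring order.refl]
  have sub: "subalgebras (ring_loc S T) (fracs R) =
      {Y. subring Y (ring_loc S T) \<and> fracs R \<subseteq> Y}"
    by (rule subalgebras_eq[OF L.is_cring fracs_R])
  \<comment> \<open>Only \<open>B\<close> is taken to be saturated, because this is applied with
    \<open>Z = R\<close>, whose saturation may be larger.\<close>
  have fracs_eq: "B = sat Z"
    if "subring B S" "R \<subseteq> B" "sat B = B" "subring Z S" "R \<subseteq> Z" "fracs B = fracs Z" for B Z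
  proof -
    have "a \<in> sat B \<longleftrightarrow> a \<in> sat Z" if "a \<in> carrier S" for a
      using frac_mem_fracs_iff[OF _ _ that one_closed] \<open>subring B S\<close> \<open>R \<subseteq> B\<close>
        \<open>subring Z S\<close> \<open>R \<subseteq> Z\<close> \<open>fracs B = fracs Z\<close> by metis
    then have "sat B = sat Z" unfolding saturation_def by blast
    then show ?thesis using that by simp
  qed
  have car: "subring (carrier S) S" "R \<subseteq> carrier S" "sat (carrier S) = carrier S"
    using carrier_is_subring subringE(1)[OF R_subring] subset_sat[of "carrier S"]
    by (auto simp: saturation_def)
  have satR: "subring (sat R) S" "R \<subseteq> sat R" "sat (sat R) = sat R"
    using sat_subring[OF R_subring] subset_sat sat_sat subringE(1)[OF R_subring] by auto
  have fracs_sat: "fracs (sat R) = fracs R"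
  proof
    show "fracs (sat R) \<subseteq> fracs R"
      using frac_mem_fracs_iff[OF R_subring order.refl] unfolding fracs_def[of "sat R"]
      by (auto simp: saturation_def[of S T R])
    show "fracs R \<subseteq> fracs (sat R)" using satR(2) unfolding fracs_def by blast
  qed
  \<comment> \<open>Equality would make \<open>sat R\<close> equal to the saturation of
    \<open>carrier S\<close>, against \<open>ne\<close>.\<close>
  have base_ne: "fracs R \<noteq> carrier (ring_loc S T)"
    using fracs_eq[OF satR car(1,2)] ne car(3) fracs_carrier fracs_sat by auto
  have car_L: "subring (carrier (ring_loc S T)) (ring_loc S T)" by (rule L.carrier_is_subring)
  show ?thesis
  proof
    assume min: "minimal_extension (ring_loc S T) (fracs R)"
    show ?rhs
    proof (intro allI impI, elim conjE)
      fix B assume B: "subring B S" "R \<subseteq> B" "sat B = B"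
      have "fracs R \<subseteq> fracs B" using B(2) unfolding fracs_def by blast
      then have "fracs B \<in> subalgebras (ring_loc S T) (fracs R)"
        unfolding sub using fracs_subring[OF B(1,2)] by blast
      then have "fracs B = fracs R \<or> fracs B = carrier (ring_loc S T)"
        using min unfolding minimal_extension_def by blast
      then show "B = sat R \<or> B = carrier S"
        using fracs_eq[OF B R_subring order.refl] fracs_eq[OF B car(1,2)] car(3) fracs_carrier
        by auto
    qed
  next
    assume rhs: ?rhs
    have "Y = fracs R \<or> Y = carrier (ring_loc S T)"
      if Y: "subring Y (ring_loc S T)" "fracs R \<subseteq> Y" for Y
    proof -
      let ?B = "{a \<in> carrier S. frac S T a \<one> \<in> Y}"
      note B = frac_pullback[OF Y]
      have "?B = sat R \<or> ?B = carrier S" using rhs B(1-3) by blast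
      then show ?thesis using B(4) fracs_sat fracs_carrier by auto
    qed
    then have "subalgebras (ring_loc S T) (fracs R) = {fracs R, carrier (ring_loc S T)}"
      unfolding sub using fracs_R car_L subringE(1)[OF fracs_R] by blast
    then show "minimal_extension (ring_loc S T) (fracs R)"
      unfolding minimal_extension_def ring_extension_def
      using L.is_cring fracs_R base_ne by blast
  qed
qed

end


subsection \<open>A pair of complementary closure operators\<close>

definition chain_of_length :: "'a set set \<Rightarrow> nat \<Rightarrow> bool"
  where "chain_of_length F n \<longleftrightarrow> (\<exists>C :: nat \<Rightarrow> 'a set. (\<forall>i\<le>n. C i \<in> F) \<and> (\<forall>i<n. C i \<subset> C (Suc i)))"

lemma chain_of_length_antimono:
  "chain_of_length F n \<Longrightarrow> m \<le> n \<Longrightarrow> chain_of_length F m"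
  unfolding chain_of_length_def by (meson le_trans less_le_trans)

text \<open>Truncating chains makes the set of their lengths downward closed, so its supremum is
  \<open>n\<close> exactly when \<open>n\<close> occurs and \<open>Suc n\<close> does not. Length
  counts strict inclusions: a chain of length \<open>n\<close> has \<open>n + 1\<close>
  members.\<close>

lemma ext_length_eq_iff:
  assumes "0 < n"
  shows "ext_length S R = enat n \<longleftrightarrow>
    chain_of_length (subalgebras S R) n \<and> \<not> chain_of_length (subalgebras S R) (Suc n)"
proof -
  let ?c = "chain_of_length (subalgebras S R)"
  have len: "ext_length S R = Sup {enat k | k. ?c k}"
    unfolding ext_length_def chain_of_length_def ..
  show ?thesis
  proof
    assume eq: "ext_length S R = enat n"
    have "\<not> ?c (Suc n)"
    proof
      assume "?c (Suc n)"
      then have "enat (Suc n) \<le> ext_length S R" unfolding len by (intro Sup_upper) blast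
      then show False unfolding eq by simp
    qed
    moreover have "?c n"
    proof (rule ccontr)
      assume nc: "\<not> ?c n"
      \<comment> \<open>As \<open>0 < n\<close>, the bound \<open>n - 1\<close> is strictly below
        \<open>n\<close> and contradicts the supremum.\<close>
      have "k \<le> n - 1" if "?c k" for k
        using chain_of_length_antimono[OF that] nc by (metis diff_Suc_1 less_eq_Suc_le not_le
            Suc_le_mono Suc_pred assms)
      then have "ext_length S R \<le> enat (n - 1)" unfolding len by (intro Sup_least) auto
      then show False using eq assms by simp
    qed
    ultimately show "?c n \<and> \<not> ?c (Suc n)" by blast
  next
    assume c: "?c n \<and> \<not> ?c (Suc n)"
    then have "k \<le> n" if "?c k" for k
      using chain_of_length_antimono[OF that, of "Suc n"] by (meson not_less_eq_eq)
    then show "ext_length S R = enat n"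
      unfolding len using c by (intro antisym Sup_least Sup_upper) auto
  qed
qed

lemma chain_of_length_2:
  assumes "A \<in> F" "B \<in> F" "C \<in> F" "A \<subset> B" "B \<subset> C"
  shows "chain_of_length F 2"
  unfolding chain_of_length_def
  using assms
  by (intro exI[of _ "(!) [A, B, C]"]) (auto simp: numeral_2_eq_2 le_Suc_eq less_Suc_eq)

lemma chain_of_length_3_iff:
  "chain_of_length F 3 \<longleftrightarrow>
    (\<exists>A\<in>F. \<exists>B\<in>F. \<exists>C\<in>F. \<exists>D\<in>F. A \<subset> B \<and> B \<subset> C \<and> C \<subset> D)" (is "?l \<longleftrightarrow> ?r")
proof
  assume ?l
  then obtain C where C: "\<And>i. i \<le> 3 \<Longrightarrow> C i \<in> F" "\<And>i. i < 3 \<Longrightarrow> C i \<subset> C (Suc i)"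
    unfolding chain_of_length_def by blast
  have "C 0 \<subset> C 1" "C 1 \<subset> C 2" "C 2 \<subset> C 3"
    using C(2)[of 0] C(2)[of 1] C(2)[of 2] by (simp_all add: numeral_2_eq_2 numeral_3_eq_3)
  moreover have "C 0 \<in> F" "C 1 \<in> F" "C 2 \<in> F" "C 3 \<in> F" using C(1) by simp_all
  ultimately show ?r by blast
next
  assume ?r
  then obtain A B C D where "A \<in> F" "B \<in> F" "C \<in> F" "D \<in> F" "A \<subset> B" "B \<subset> C" "C \<subset> D"
    by blast
  then show ?l
    unfolding chain_of_length_def
    by (intro exI[of _ "(!) [A, B, C, D]"]) (auto simp: numeral_3_eq_3 le_Suc_eq less_Suc_eq)
qed

text \<open>The order-theoretic core: \<open>F\<close> stands for \<open>[R, S]\<close>, and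
  \<open>f\<close>, \<open>g\<close> for the saturations at the two primes of the support. That they
  enlarge the members of \<open>F\<close> is implied by \<open>f_Int_g\<close>.\<close>

locale complementary_closures =
  fixes F :: "'a set set" and R U :: "'a set" and f g :: "'a set \<Rightarrow> 'a set"
  assumes bounds: "R \<in> F" "U \<in> F" "\<And>B. B \<in> F \<Longrightarrow> R \<subseteq> B \<and> B \<subseteq> U"
    and f_closed: "\<And>B. B \<in> F \<Longrightarrow> f B \<in> F" and g_closed: "\<And>B. B \<in> F \<Longrightarrow> g B \<in> F"
    and f_mono: "\<And>B C. B \<subseteq> C \<Longrightarrow> f B \<subseteq> f C" and g_mono: "\<And>B C. B \<subseteq> C \<Longrightarrow> g B \<subseteq> g C"
    and f_idem: "\<And>B. B \<in> F \<Longrightarrow> f (f B) = f B" and g_idem: "\<And>B. B \<in> F \<Longrightarrow> g (g B) = g B"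
    and f_g: "f (g R) = U" and g_f: "g (f R) = U"
    and f_Int_g: "\<And>B. B \<in> F \<Longrightarrow> f B \<inter> g B = B"
    and f_ne: "f R \<noteq> U" and g_ne: "g R \<noteq> U"
begin

text \<open>The abstract form of local minimality, with one conjunct for each of the two
  primes.\<close>

definition closures_trivial :: bool
  where "closures_trivial \<longleftrightarrow>
    (\<forall>B\<in>F. (f B = B \<longrightarrow> B = f R \<or> B = U) \<and> (g B = B \<longrightarrow> B = g R \<or> B = U))"

text \<open>Applying \<open>g\<close> to \<open>f R \<subseteq> g R\<close> would give
  \<open>U \<subseteq> g R\<close> by \<open>g_f\<close> and idempotence; the other case is
  symmetric.\<close>

lemma incomparable: "\<not> f R \<subseteq> g R" "\<not> g R \<subseteq> f R"
proof -
  show "\<not> f R \<subseteq> g R"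
  proof
    assume "f R \<subseteq> g R"
    then have "U \<subseteq> g R" using g_mono[of "f R" "g R"] g_f g_idem[OF bounds(1)] by simp
    then show False using bounds(3)[OF g_closed[OF bounds(1)]] g_ne by auto
  qed
  show "\<not> g R \<subseteq> f R"
  proof
    assume "g R \<subseteq> f R"
    then have "U \<subseteq> f R" using f_mono[of "g R" "f R"] f_g f_idem[OF bounds(1)] by simp
    then show False using bounds(3)[OF f_closed[OF bounds(1)]] f_ne by auto
  qed
qed

lemma strict: "R \<subset> f R" "R \<subset> g R" "f R \<subset> U" "g R \<subset> U"
  using incomparable bounds(3)[OF f_closed[OF bounds(1)]] bounds(3)[OF g_closed[OF bounds(1)]]
    f_ne g_ne by auto

lemma card_four: "card {R, f R, g R, U} = 4"
proof -
  have "R \<noteq> f R" "R \<noteq> g R" "R \<noteq> U" "f R \<noteq> U" "g R \<noteq> U" using strict by auto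
  moreover have "f R \<noteq> g R" using incomparable(1) by auto
  ultimately show ?thesis by simp
qed

lemma four_subset: "{R, f R, g R, U} \<subseteq> F"
  using bounds(1,2) f_closed[OF bounds(1)] g_closed[OF bounds(1)] by simp

text \<open>Each \<open>B\<close> is \<open>f B \<inter> g B\<close>, and triviality leaves two
  values for either factor, hence four intersections. Conversely, \<open>g R\<close> is not closed
  under \<open>f\<close> because \<open>f (g R) = U\<close>, and likewise with the operators
  exchanged.\<close>

lemma closures_trivial_iff: "closures_trivial \<longleftrightarrow> F = {R, f R, g R, U}"
proof
  assume triv: closures_trivial
  have "B \<in> {R, f R, g R, U}" if B: "B \<in> F" for B
  proof -
    have cases: "f B = f R \<or> f B = U" "g B = g R \<or> g B = U"
      using triv[unfolded closures_trivial_def] f_closed[OF B] g_closed[OF B] f_idem[OF B]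
        g_idem[OF B] by simp_all
    have "f R \<inter> U = f R" "U \<inter> g R = g R" "f R \<inter> g R = R"
      using strict f_Int_g[OF bounds(1)] by blast+
    then have "f B \<inter> g B \<in> {R, f R, g R, U}"
      using cases by (elim disjE) simp_all
    then show ?thesis unfolding f_Int_g[OF B] .
  qed
  then show "F = {R, f R, g R, U}" using four_subset by blast
next
  assume F: "F = {R, f R, g R, U}"
  have "f R \<noteq> R" "g R \<noteq> R" "f (g R) \<noteq> g R" "g (f R) \<noteq> f R"
    using strict f_g g_f by auto
  then have "\<forall>B\<in>{R, f R, g R, U}.
      (f B = B \<longrightarrow> B = f R \<or> B = U) \<and> (g B = B \<longrightarrow> B = g R \<or> B = U)"
    by simp
  then show closures_trivial unfolding closures_trivial_def by (simp only: F)
qed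

text \<open>The four distinct sets always belong to \<open>F\<close>, so having cardinality 4 means
  having no further members.\<close>

lemma card_eq_4_iff: "card F = 4 \<longleftrightarrow> closures_trivial"
proof
  assume "card F = 4"
  \<comment> \<open>An infinite set would have \<open>card\<close> equal to 0.\<close>
  then have "finite F" by (metis card.infinite zero_neq_numeral)
  then show closures_trivial
    using card_subset_eq[OF _ four_subset] card_four \<open>card F = 4\<close> closures_trivial_iff by simp
qed (simp only: closures_trivial_iff card_four)

text \<open>A further closed set \<open>B\<close> refines \<open>R \<subset> f R \<subset> U\<close>
  or \<open>R \<subset> g R \<subset> U\<close> to a chain of length 3. With only four members, the
  two middle terms of such a chain would have to be \<open>f R\<close> and \<open>g R\<close>, which
  are incomparable.\<close>

lemma chain_3_iff: "\<not> chain_of_length F 3 \<longleftrightarrow> closures_trivial"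
proof
  assume no: "\<not> chain_of_length F 3"
  have "B = f R \<or> B = U" if B: "B \<in> F" "f B = B" for B
  proof (rule ccontr)
    assume ne: "\<not> (B = f R \<or> B = U)"
    then have "f R \<subset> B" "B \<subset> U"
      using f_mono[of R B] bounds(3)[OF B(1)] B(2) by auto
    then show False
      using no strict(1) B(1) bounds(1,2) f_closed[OF bounds(1)]
      unfolding chain_of_length_3_iff by blast
  qed
  moreover have "B = g R \<or> B = U" if B: "B \<in> F" "g B = B" for B
  proof (rule ccontr)
    assume ne: "\<not> (B = g R \<or> B = U)"
    then have "g R \<subset> B" "B \<subset> U"
      using g_mono[of R B] bounds(3)[OF B(1)] B(2) by auto
    then show False
      using no strict(2) B(1) bounds(1,2) g_closed[OF bounds(1)]
      unfolding chain_of_length_3_iff by blast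
  qed
  ultimately show closures_trivial unfolding closures_trivial_def by blast
next
  assume closures_trivial
  then have F: "F = {R, f R, g R, U}" using closures_trivial_iff by simp
  show "\<not> chain_of_length F 3"
  proof
    assume "chain_of_length F 3"
    then obtain A B C D where c: "A \<in> F" "B \<in> F" "C \<in> F" "D \<in> F" "A \<subset> B" "B \<subset> C" "C \<subset> D"
      unfolding chain_of_length_3_iff by blast
    then have "B \<noteq> R" "C \<noteq> R" "B \<noteq> U" "C \<noteq> U"
      using bounds(3)[OF c(1)] bounds(3)[OF c(4)] by auto
    then have "B = f R \<or> B = g R" "C = f R \<or> C = g R" using c(2,3) unfolding F by auto
    then show False using incomparable c(6) by auto
  qed
qed

lemma chain_2: "chain_of_length F 2"
  using chain_of_length_2[OF bounds(1) f_closed[OF bounds(1)] bounds(2)] strict by blast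

end


subsection \<open>The support of a ring extension\<close>

locale cring_with_subring = cring S for S (structure) +
  fixes R
  assumes R_subring: "subring R S"
begin

lemma R_carrier: "r \<in> R \<Longrightarrow> r \<in> carrier S"
  using subringE(1)[OF R_subring] by blast

sublocale R_add: abelian_subgroup R S
  using subring.axioms(1)[OF R_subring] is_abelian_group
  by (intro abelian_subgroupI3 additive_subgroup.intro)

lemma coset_eq_iff:
  assumes "a \<in> carrier S" "b \<in> carrier S"
  shows "R +> a = R +> b \<longleftrightarrow> a \<ominus> b \<in> R"
proof
  assume "R +> a = R +> b"
  then have "a \<in> R +> b" using R_add.a_rcos_self[OF assms(1)] by simp
  then show "a \<ominus> b \<in> R" using R_add.a_rcos_module[OF assms(2,1)] by (simp add: minus_eq)
next
  assume "a \<ominus> b \<in> R"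
  then have "a \<in> R +> b" using R_add.a_rcos_module[OF assms(2,1)] by (simp add: minus_eq)
  then show "R +> a = R +> b"
    using a_repr_independence[OF _ assms(2) subring.axioms(1)[OF R_subring]] by simp
qed

section \<open>The quotient module \<open>S/R\<close> and the vanishing of its localizations\<close>

abbreviation quot :: "('a, 'a set) module"
  where "quot \<equiv> quot_module (ring_as_module S) R"

lemma coset_ring_as_module: "R +>\<^bsub>ring_as_module S\<^esub> a = R +> a"
  by (simp add: a_r_coset_def' ring_as_module_def)

lemma quot_simps:
  shows quot_carrier: "carrier quot = {R +> a | a. a \<in> carrier S}"
    and quot_zero: "\<zero>\<^bsub>quot\<^esub> = R +> \<zero>"
    and quot_add: "\<And>a b. a \<in> carrier S \<Longrightarrow> b \<in> carrier S \<Longrightarrow>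
      (R +> a) \<oplus>\<^bsub>quot\<^esub> (R +> b) = R +> (a \<oplus> b)"
    and quot_smult: "\<And>r a. r \<in> R \<Longrightarrow> a \<in> carrier S \<Longrightarrow> r \<odot>\<^bsub>quot\<^esub> (R +> a) = R +> (r \<otimes> a)"
proof -
  have "carrier (ring_as_module S) = carrier S" by (simp add: ring_as_module_def)
  then show "carrier quot = {R +> a | a. a \<in> carrier S}"
    by (auto simp: quot_module_def A_RCOSETS_def' coset_ring_as_module)
  have "R +> \<zero> = R" using a_coset_add_zero R_add.a_subset by simp
  then show "\<zero>\<^bsub>quot\<^esub> = R +> \<zero>" by (simp add: quot_module_def)
  show "(R +> a) \<oplus>\<^bsub>quot\<^esub> (R +> b) = R +> (a \<oplus> b)" if "a \<in> carrier S" "b \<in> carrier S" for a b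
    using R_add.a_rcos_sum[OF that]
    by (simp add: quot_module_def set_add_def' ring_as_module_def)
  show "r \<odot>\<^bsub>quot\<^esub> (R +> a) = R +> (r \<otimes> a)" if r: "r \<in> R" and a: "a \<in> carrier S" for r a
  proof -
    \<comment> \<open>Scalar multiplication is a union over the elements of a coset; all of them
      give the same coset because \<open>R\<close> is closed under multiplication by
      \<open>r\<close>.\<close>
    have "R +> (r \<otimes> x) = R +> (r \<otimes> a)" if x: "x \<in> R +> a" for x
    proof -
      have xc: "x \<in> carrier S"
        using a_r_coset_subset_G[OF R_add.a_subset a] x by blast
      have "x \<ominus> a \<in> R" using R_add.a_rcos_module[OF a xc] x by (simp add: minus_eq)
      then have "r \<otimes> (x \<ominus> a) \<in> R" using subringE(6)[OF R_subring r] by simp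
      moreover have "r \<otimes> (x \<ominus> a) = r \<otimes> x \<ominus> r \<otimes> a"
        using R_carrier[OF r] a xc by algebra
      ultimately show ?thesis using coset_eq_iff R_carrier[OF r] a xc by simp
    qed
    moreover have "R +> a \<noteq> {}" using R_add.a_rcos_self[OF a] by blast
    moreover have "smult (ring_as_module S) = mult S" by (simp add: ring_as_module_def)
    ultimately show ?thesis by (simp add: quot_module_def coset_ring_as_module)
  qed
qed

text \<open>The relation \<open>mod_loc_rel\<close> uses subtraction in the module, and negatives of
  cosets can be computed once the quotient is known to be an abelian group.\<close>

lemma quot_minus:
  assumes "a \<in> carrier S" "b \<in> carrier S"
  shows "(R +> a) \<ominus>\<^bsub>quot\<^esub> (R +> b) = R +> (a \<ominus> b)"
proof -
  interpret Q: abelian_group quot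
  proof (rule abelian_groupI)
    show "\<zero>\<^bsub>quot\<^esub> \<in> carrier quot" unfolding quot_zero quot_carrier by blast
    fix x assume "x \<in> carrier quot"
    then obtain a where x: "a \<in> carrier S" "x = R +> a" unfolding quot_carrier by blast
    show "\<zero>\<^bsub>quot\<^esub> \<oplus>\<^bsub>quot\<^esub> x = x" using x by (simp add: quot_zero quot_add)
    have "(R +> \<ominus> a) \<oplus>\<^bsub>quot\<^esub> x = \<zero>\<^bsub>quot\<^esub>" using x by (simp add: quot_zero quot_add l_neg)
    moreover have "R +> \<ominus> a \<in> carrier quot" using x unfolding quot_carrier by blast
    ultimately show "\<exists>y\<in>carrier quot. y \<oplus>\<^bsub>quot\<^esub> x = \<zero>\<^bsub>quot\<^esub>" by blast
    fix y assume "y \<in> carrier quot"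
    then obtain b where y: "b \<in> carrier S" "y = R +> b" unfolding quot_carrier by blast
    have "R +> (a \<oplus> b) \<in> carrier quot" using x y unfolding quot_carrier by blast
    then show "x \<oplus>\<^bsub>quot\<^esub> y \<in> carrier quot" using x y by (simp add: quot_add)
    show "x \<oplus>\<^bsub>quot\<^esub> y = y \<oplus>\<^bsub>quot\<^esub> x" using x y by (simp add: quot_add a_comm)
    fix z assume "z \<in> carrier quot"
    then obtain c where z: "c \<in> carrier S" "z = R +> c" unfolding quot_carrier by blast
    show "x \<oplus>\<^bsub>quot\<^esub> y \<oplus>\<^bsub>quot\<^esub> z = x \<oplus>\<^bsub>quot\<^esub> (y \<oplus>\<^bsub>quot\<^esub> z)"
      using x y z by (simp add: quot_add a_assoc)
  qed
  have mem: "R +> c \<in> carrier quot" if "c \<in> carrier S" for c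
    using that unfolding quot_carrier by blast
  have "\<ominus>\<^bsub>quot\<^esub> (R +> b) = R +> (\<ominus> b)"
    using assms mem by (intro Q.minus_equality) (auto simp: quot_add quot_zero l_neg)
  then show ?thesis using assms by (simp add: a_minus_def quot_add)
qed

lemma mod_loc_rel_quot_iff:
  assumes "T \<subseteq> R" "a \<in> carrier S" "b \<in> carrier S" "s \<in> T" "t \<in> T"
  shows "((R +> a, s), (R +> b, t)) \<in> mod_loc_rel quot T \<longleftrightarrow>
    (\<exists>u\<in>T. u \<otimes> (t \<otimes> a \<ominus> s \<otimes> b) \<in> R)"
proof -
  have TR: "u \<in> R" "u \<in> carrier S" if "u \<in> T" for u using that assms(1) R_carrier by auto
  have mem: "R +> c \<in> carrier quot" if "c \<in> carrier S" for c
    using that unfolding quot_carrier by blast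
  have zero_iff: "R +> c = R +> \<zero> \<longleftrightarrow> c \<in> R" if "c \<in> carrier S" for c
    using coset_eq_iff[OF that zero_closed] that by (simp add: a_minus_def)
  have "u \<odot>\<^bsub>quot\<^esub> (t \<odot>\<^bsub>quot\<^esub> (R +> a) \<ominus>\<^bsub>quot\<^esub> s \<odot>\<^bsub>quot\<^esub> (R +> b)) = \<zero>\<^bsub>quot\<^esub> \<longleftrightarrow>
      u \<otimes> (t \<otimes> a \<ominus> s \<otimes> b) \<in> R" if "u \<in> T" for u
    using assms(2-5) TR that
    by (simp add: quot_smult quot_minus quot_zero zero_iff)
  then show ?thesis unfolding mod_loc_rel_def using assms mem by simp
qed

text \<open>The localization vanishes exactly when every element of \<open>S\<close> has a multiple
  by some element of \<open>T\<close> that lies in \<open>R\<close>: then any two pairs are related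
  and there is a single class.\<close>

lemma module_loc_quot_nonzero_iff:
  assumes "submonoid T S" "T \<subseteq> R"
  shows "carrier (module_loc A quot T) \<noteq> {mod_frac quot T \<zero>\<^bsub>quot\<^esub> \<one>} \<longleftrightarrow>
    (\<exists>a\<in>carrier S. \<forall>u\<in>T. u \<otimes> a \<notin> R)"
proof -
  have TR: "u \<in> R" "u \<in> carrier S" if "u \<in> T" for u using that assms(2) R_carrier by auto
  have one: "\<one> \<in> T" using submonoid.one_closed[OF assms(1)] .
  have mult: "u \<otimes> v \<in> T" if "u \<in> T" "v \<in> T" for u v using submonoid.m_closed[OF assms(1) that] .
  have car: "carrier (module_loc A quot T) =
      (\<Union>x\<in>carrier quot \<times> T. {mod_frac quot T (fst x) (snd x)})"
    by (simp add: module_loc_def quotient_def mod_frac_def)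
  have frac_mem: "mod_frac quot T (R +> a) s \<in> carrier (module_loc A quot T)"
    if "a \<in> carrier S" "s \<in> T" for a s
    unfolding car by (rule UN_I[of "(R +> a, s)"]) (use that in \<open>auto simp: quot_carrier\<close>)
  have "carrier (module_loc A quot T) = {mod_frac quot T \<zero>\<^bsub>quot\<^esub> \<one>} \<longleftrightarrow>
    (\<forall>a\<in>carrier S. \<exists>u\<in>T. u \<otimes> a \<in> R)"
  proof
    assume triv: "carrier (module_loc A quot T) = {mod_frac quot T \<zero>\<^bsub>quot\<^esub> \<one>}"
    show "\<forall>a\<in>carrier S. \<exists>u\<in>T. u \<otimes> a \<in> R"
    proof
      fix a assume a: "a \<in> carrier S"
      have eq: "mod_frac quot T (R +> a) \<one> = mod_frac quot T (R +> \<zero>) \<one>"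
        using frac_mem[OF a one] unfolding triv quot_zero by simp
      \<comment> \<open>Reflexivity at the zero pair puts that pair into its own class, so by
        \<open>eq\<close> also into the class of \<open>a\<close>.\<close>
      have "\<one> \<otimes> (\<one> \<otimes> \<zero> \<ominus> \<one> \<otimes> \<zero>) \<in> R"
        using subringE(2)[OF R_subring] by (simp add: a_minus_def)
      then have "((R +> \<zero>, \<one>), (R +> \<zero>, \<one>)) \<in> mod_loc_rel quot T"
        using mod_loc_rel_quot_iff[OF assms(2) zero_closed zero_closed one one] one by blast
      then have "(R +> \<zero>, \<one>) \<in> mod_frac quot T (R +> a) \<one>"
        unfolding eq by (simp add: mod_frac_def)
      then have "((R +> a, \<one>), (R +> \<zero>, \<one>)) \<in> mod_loc_rel quot T"
        by (simp add: mod_frac_def)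
      then show "\<exists>u\<in>T. u \<otimes> a \<in> R"
        using mod_loc_rel_quot_iff[OF assms(2) a zero_closed one one] a by (simp add: a_minus_def)
    qed
  next
    assume all: "\<forall>a\<in>carrier S. \<exists>u\<in>T. u \<otimes> a \<in> R"
    \<comment> \<open>The hypothesis is applied to the element
      \<open>t \<otimes> a \<ominus> s \<otimes> b\<close>.\<close>
    have rel: "((R +> a, s), (R +> b, t)) \<in> mod_loc_rel quot T"
      if "a \<in> carrier S" "b \<in> carrier S" "s \<in> T" "t \<in> T" for a b s t
      using mod_loc_rel_quot_iff[OF assms(2) that] all that TR by simp
    have frac: "mod_frac quot T x s = carrier quot \<times> T"
      if x: "x \<in> carrier quot" and s: "s \<in> T" for x s
    proof
      show "mod_frac quot T x s \<subseteq> carrier quot \<times> T"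
        unfolding mod_frac_def mod_loc_rel_def by auto
      show "carrier quot \<times> T \<subseteq> mod_frac quot T x s"
      proof
        fix y assume "y \<in> carrier quot \<times> T"
        then obtain b t where y: "b \<in> carrier S" "t \<in> T" "y = (R +> b, t)"
          unfolding quot_carrier by blast
        obtain a where "a \<in> carrier S" "x = R +> a" using x unfolding quot_carrier by blast
        then show "y \<in> mod_frac quot T x s"
          unfolding mod_frac_def using rel[of a b s t] y s by simp
      qed
    qed
    have "\<zero>\<^bsub>quot\<^esub> \<in> carrier quot" unfolding quot_zero quot_carrier by blast
    then have "y = mod_frac quot T \<zero>\<^bsub>quot\<^esub> \<one>" if "y \<in> carrier (module_loc A quot T)" for y
      using that frac one unfolding car by auto
    then show "carrier (module_loc A quot T) = {mod_frac quot T \<zero>\<^bsub>quot\<^esub> \<one>}"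
      using frac_mem[OF zero_closed one] unfolding quot_zero by blast
  qed
  then show ?thesis by blast
qed

section \<open>The support through saturations, and passing from local to global membership\<close>

lemma prime_subset: "primeideal P (S\<lparr>carrier := R\<rparr>) \<Longrightarrow> P \<subseteq> R"
  using additive_subgroup.a_subset[OF ideal.axioms(1)[OF primeideal.axioms(1)]] by fastforce

lemma subring_localization_prime:
  assumes "primeideal P (S\<lparr>carrier := R\<rparr>)"
  shows "subring_localization S (R - P) R"
proof -
  interpret P: primeideal P "S\<lparr>carrier := R\<rparr>" by fact
  have "\<one> \<notin> P" using P.one_imp_carrier P.I_notcarr by auto
  then have "submonoid (R - P) S"
    using R_carrier subringE(3,6)[OF R_subring] P.I_prime by (auto intro!: submonoid.intro)
  then show ?thesis
    by (intro subring_localization.intro localization.intro subring_localization_axioms.intro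
        is_cring R_subring) auto
qed

text \<open>From here on the quotient module is replaced by saturations: \<open>S/R\<close> vanishes
  at \<open>P\<close> when each element of \<open>S\<close> is carried into \<open>R\<close> by a
  multiplier outside \<open>P\<close>.\<close>

lemma ext_support_iff:
  "P \<in> ext_support S R \<longleftrightarrow>
    primeideal P (S\<lparr>carrier := R\<rparr>) \<and> saturation S (R - P) R \<noteq> carrier S"
proof (cases "primeideal P (S\<lparr>carrier := R\<rparr>)")
  case True
  then interpret P: subring_localization S "R - P" R by (rule subring_localization_prime)
  have "\<zero>\<^bsub>module_loc (S\<lparr>carrier := R\<rparr>) quot (R - P)\<^esub> = mod_frac quot (R - P) \<zero>\<^bsub>quot\<^esub> \<one>"
    by (simp add: module_loc_def)
  then have "P \<in> ext_support S R \<longleftrightarrow> (\<exists>a\<in>carrier S. \<forall>u\<in>R - P. u \<otimes> a \<notin> R)"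
    using module_loc_quot_nonzero_iff[OF P.submonoid_axioms P.T_sub] True
    by (simp add: ext_support_def module_support_def Spec_def)
  also have "\<dots> \<longleftrightarrow> saturation S (R - P) R \<noteq> carrier S"
    unfolding saturation_def by blast
  finally show ?thesis using True by blast
next
  case False
  then show ?thesis by (simp add: ext_support_def module_support_def Spec_def)
qed

abbreviation sat_at :: "'a set \<Rightarrow> 'a set \<Rightarrow> 'a set"
  where "sat_at P \<equiv> saturation S (R - P)"

lemma mem_subalgebras: "B \<in> subalgebras S R \<longleftrightarrow> subring B S \<and> R \<subseteq> B"
  using subalgebras_eq[OF is_cring R_subring] by simp

text \<open>This is the conductor of \<open>a\<close> into \<open>B\<close>; it is an ideal because
  \<open>B\<close> is closed under multiplication by \<open>R\<close>.\<close>

lemma conductor_ideal: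
  assumes B: "B \<in> subalgebras S R" and a: "a \<in> carrier S"
  shows "ideal {r \<in> R. r \<otimes> a \<in> B} (S\<lparr>carrier := R\<rparr>)"
proof -
  interpret RR: cring "S\<lparr>carrier := R\<rparr>" by (rule subring_is_cring[OF R_subring])
  have sub: "subring B S" "R \<subseteq> B" using B mem_subalgebras by auto
  have scal: "x \<otimes> r \<in> R \<and> (x \<otimes> r) \<otimes> a \<in> B" if "r \<in> R" "r \<otimes> a \<in> B" "x \<in> R" for r x
    using that subringE(6)[OF R_subring] subringE(6)[OF sub(1), of x "r \<otimes> a"] sub(2) R_carrier a
    by (auto simp: m_assoc)
  show ?thesis
  proof (rule idealI[OF RR.ring_axioms])
    show "subgroup {r \<in> R. r \<otimes> a \<in> B} (add_monoid (S\<lparr>carrier := R\<rparr>))"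
    proof (rule RR.add.subgroupI)
      have "\<zero> \<in> {r \<in> R. r \<otimes> a \<in> B}"
        using subringE(2)[OF R_subring] subringE(2)[OF sub(1)] a by simp
      then show "{r \<in> R. r \<otimes> a \<in> B} \<noteq> {}" by blast
      fix r assume r: "r \<in> {r \<in> R. r \<otimes> a \<in> B}"
      have "\<ominus> r \<in> R" "\<ominus> r \<otimes> a \<in> B"
        using r subringE(5)[OF R_subring] subringE(5)[OF sub(1)] R_carrier a
        by (auto simp: l_minus)
      then show "\<ominus>\<^bsub>S\<lparr>carrier := R\<rparr>\<^esub> r \<in> {r \<in> R. r \<otimes> a \<in> B}"
        using r a_inv_subring[OF R_subring] by simp
      fix q assume q: "q \<in> {r \<in> R. r \<otimes> a \<in> B}"
      show "r \<oplus>\<^bsub>S\<lparr>carrier := R\<rparr>\<^esub> q \<in> {r \<in> R. r \<otimes> a \<in> B}"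
        using r q subringE(7)[OF R_subring] subringE(7)[OF sub(1)] R_carrier a
        by (auto simp: l_distr)
    qed auto
  next
    fix r x assume "r \<in> {r \<in> R. r \<otimes> a \<in> B}" "x \<in> carrier (S\<lparr>carrier := R\<rparr>)"
    then have "x \<otimes> r \<in> R \<and> (x \<otimes> r) \<otimes> a \<in> B" "r \<otimes> x = x \<otimes> r"
      using scal R_carrier by (auto simp: m_comm)
    then show "x \<otimes>\<^bsub>S\<lparr>carrier := R\<rparr>\<^esub> r \<in> {r \<in> R. r \<otimes> a \<in> B}"
      "r \<otimes>\<^bsub>S\<lparr>carrier := R\<rparr>\<^esub> x \<in> {r \<in> R. r \<otimes> a \<in> B}" by auto
  qed
qed

text \<open>
  If no element of \<open>W\<close> works, some prime disjoint from \<open>W\<close> contains the conductor of \<open>a\<close> into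
  \<open>B\<close>, hence that of \<open>a\<close> into \<open>R\<close>, and so lies in the support.
\<close>

lemma exists_multiplier:
  assumes B: "B \<in> subalgebras S R" and a: "a \<in> carrier S"
    and W: "submonoid W (S\<lparr>carrier := R\<rparr>)"
    and supp: "\<And>P. P \<in> ext_support S R \<Longrightarrow> P \<inter> W = {} \<Longrightarrow> a \<in> sat_at P B"
  shows "\<exists>w\<in>W. w \<otimes> a \<in> B"
proof (rule ccontr)
  assume no: "\<not> (\<exists>w\<in>W. w \<otimes> a \<in> B)"
  let ?I = "{r \<in> R. r \<otimes> a \<in> B}"
  have "?I \<inter> W = {}" using no by blast
  then obtain P where P: "primeideal P (S\<lparr>carrier := R\<rparr>)" "?I \<subseteq> P" "P \<inter> W = {}"
    using cring.exists_prime_disjoint_submonoid[OF subring_is_cring[OF R_subring] conductor_ideal[OF B a] W] by blast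
  have notin: "a \<notin> sat_at P B" using P(2) unfolding saturation_def by blast
  have "R \<subseteq> B" using B mem_subalgebras by blast
  then have "a \<notin> sat_at P R" using notin unfolding saturation_def by blast
  then have "P \<in> ext_support S R" using ext_support_iff P(1) a by blast
  then show False using supp P(3) notin by blast
qed

text \<open>The local-global principle, obtained from \<open>exists_multiplier\<close> with the
  trivial multiplicative set: only the primes of the support need to be tested.\<close>

lemma mem_of_mem_sat_at:
  assumes B: "B \<in> subalgebras S R" and a: "a \<in> carrier S"
    and supp: "\<And>P. P \<in> ext_support S R \<Longrightarrow> a \<in> sat_at P B"
  shows "a \<in> B"
proof -
  interpret RR: cring "S\<lparr>carrier := R\<rparr>" by (rule subring_is_cring[OF R_subring])
  have "submonoid {\<one>} (S\<lparr>carrier := R\<rparr>)"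
    using subringE(3)[OF R_subring] by (intro submonoid.intro) auto
  then show ?thesis using exists_multiplier[OF B a, of "{\<one>}"] supp a by simp
qed

text \<open>Membership in the double saturation asks for a multiplier that is a product of an
  element outside \<open>M\<close> and one outside \<open>N\<close>. These products form a
  multiplicative set \<open>?W\<close> that meets both primes of the support.\<close>

lemma sat_at_sat_at:
  assumes supp: "ext_support S R = {M, N}" and "\<not> M \<subseteq> N" "\<not> N \<subseteq> M"
  shows "sat_at M (sat_at N R) = carrier S"
proof -
  have prime: "primeideal M (S\<lparr>carrier := R\<rparr>)" "primeideal N (S\<lparr>carrier := R\<rparr>)"
    using supp ext_support_iff by auto
  interpret M: subring_localization S "R - M" R using subring_localization_prime[OF prime(1)] .
  interpret N: subring_localization S "R - N" R using subring_localization_prime[OF prime(2)] .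
  have sub: "M \<subseteq> R" "N \<subseteq> R" using prime prime_subset by auto
  let ?W = "{v \<otimes> u | u v. u \<in> R - M \<and> v \<in> R - N}"
  have W: "submonoid ?W (S\<lparr>carrier := R\<rparr>)"
  proof
    show "?W \<subseteq> carrier (S\<lparr>carrier := R\<rparr>)" using subringE(6)[OF R_subring] by auto
    have "\<one> \<otimes> \<one> \<in> ?W" using M.one_closed N.one_closed by blast
    then show "\<one>\<^bsub>S\<lparr>carrier := R\<rparr>\<^esub> \<in> ?W" by simp
    fix x y assume "x \<in> ?W" "y \<in> ?W"
    then obtain u v u' v' where u: "u \<in> R - M" "u' \<in> R - M" and v: "v \<in> R - N" "v' \<in> R - N"
      and xy: "x = v \<otimes> u" "y = v' \<otimes> u'" by blast
    have "u \<otimes> u' \<in> R - M" "v \<otimes> v' \<in> R - N"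
      using submonoid.m_closed[OF M.submonoid_axioms u]
        submonoid.m_closed[OF N.submonoid_axioms v] by auto
    moreover have "x \<otimes> y = (v \<otimes> v') \<otimes> (u \<otimes> u')"
      unfolding xy using u v R_carrier by (simp add: m_ac)
    ultimately show "x \<otimes>\<^bsub>S\<lparr>carrier := R\<rparr>\<^esub> y \<in> ?W" by auto
  qed
  have meet: "P \<inter> ?W \<noteq> {}" if P: "P \<in> ext_support S R" for P
  proof -
    \<comment> \<open>Incomparability supplies \<open>m\<close> and \<open>n\<close>; each is in
      \<open>?W\<close> with \<open>\<one>\<close> as the other factor.\<close>
    obtain m n where m: "m \<in> M" "m \<notin> N" and n: "n \<in> N" "n \<notin> M" using assms(2,3) by blast
    have "m = m \<otimes> \<one>" "n = \<one> \<otimes> n" using m n sub R_carrier by auto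
    then have "m \<in> ?W" "n \<in> ?W" using m n sub M.one_closed N.one_closed by blast+
    then show ?thesis using P m(1) n(1) unfolding supp by blast
  qed
  have R: "R \<in> subalgebras S R" using mem_subalgebras R_subring by blast
  have "a \<in> sat_at M (sat_at N R)" if a: "a \<in> carrier S" for a
  proof -
    \<comment> \<open>No prime of the support misses \<open>?W\<close>, so the local condition of
      \<open>exists_multiplier\<close> is vacuous.\<close>
    obtain u v where u: "u \<in> R - M" "v \<in> R - N" "(v \<otimes> u) \<otimes> a \<in> R"
      using exists_multiplier[OF R a W] meet by blast
    then have "v \<otimes> (u \<otimes> a) \<in> R" using R_carrier a by (auto simp: m_assoc)
    then have "u \<otimes> a \<in> sat_at N R"
      using u(1,2) R_carrier a unfolding saturation_def by auto
    then show ?thesis using u(1) a unfolding saturation_def[of S "R - M"] by blast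
  qed
  then show ?thesis by (auto simp: saturation_def)
qed

lemma minimal_extension_at_iff:
  assumes "P \<in> ext_support S R"
  shows "minimal_extension (ring_at S R P) (base_at S R P) \<longleftrightarrow>
    (\<forall>B\<in>subalgebras S R. sat_at P B = B \<longrightarrow> B = sat_at P R \<or> B = carrier S)"
proof -
  have P: "primeideal P (S\<lparr>carrier := R\<rparr>)" "sat_at P R \<noteq> carrier S"
    using assms ext_support_iff by auto
  interpret P: subring_localization S "R - P" R using subring_localization_prime[OF P(1)] .
  show ?thesis
    unfolding ring_at_def base_at_def P.base_eq_fracs P.minimal_extension_loc_iff[OF P(2)]
    using mem_subalgebras by blast
qed

lemma sat_at_subalgebra:
  assumes "primeideal P (S\<lparr>carrier := R\<rparr>)" "B \<in> subalgebras S R"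
  shows "sat_at P B \<in> subalgebras S R" "B \<subseteq> sat_at P B" "sat_at P (sat_at P B) = sat_at P B"
proof -
  interpret P: subring_localization S "R - P" R using subring_localization_prime[OF assms(1)] .
  have B: "subring B S" "R \<subseteq> B" "B \<subseteq> carrier S"
    using assms(2) mem_subalgebras subringE(1)[of B S] by auto
  show "B \<subseteq> sat_at P B" "sat_at P (sat_at P B) = sat_at P B"
    using P.subset_sat P.sat_sat B(3) by auto
  then show "sat_at P B \<in> subalgebras S R" using P.sat_subring B(1,2) mem_subalgebras by auto
qed

text \<open>The composites come from \<open>sat_at_sat_at\<close> in both orders, and the
  intersection property from \<open>mem_of_mem_sat_at\<close>, since \<open>M\<close> and
  \<open>N\<close> exhaust the support.\<close>

lemma complementary_closures_sat_at:
  assumes supp: "ext_support S R = {M, N}" and "\<not> M \<subseteq> N" "\<not> N \<subseteq> M"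
  shows "complementary_closures (subalgebras S R) R (carrier S) (sat_at M) (sat_at N)"
proof
  have prime: "primeideal M (S\<lparr>carrier := R\<rparr>)" "primeideal N (S\<lparr>carrier := R\<rparr>)"
    and ne: "sat_at M R \<noteq> carrier S" "sat_at N R \<noteq> carrier S"
    using supp ext_support_iff by auto
  show "R \<in> subalgebras S R" "carrier S \<in> subalgebras S R"
    using mem_subalgebras R_subring carrier_is_subring R_carrier by auto
  show "sat_at M R \<noteq> carrier S" "sat_at N R \<noteq> carrier S" by (rule ne)+
  show "sat_at M (sat_at N R) = carrier S" "sat_at N (sat_at M R) = carrier S"
    using sat_at_sat_at[of M N] sat_at_sat_at[of N M] assms by (auto simp: insert_commute)
  show "sat_at M B \<subseteq> sat_at M C" "sat_at N B \<subseteq> sat_at N C" if "B \<subseteq> C" for B C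
    using that unfolding saturation_def by blast+
  fix B assume B: "B \<in> subalgebras S R"
  show "R \<subseteq> B \<and> B \<subseteq> carrier S" using B mem_subalgebras subringE(1) by blast
  note M = sat_at_subalgebra[OF prime(1) B] and N = sat_at_subalgebra[OF prime(2) B]
  show "sat_at M B \<in> subalgebras S R" "sat_at N B \<in> subalgebras S R"
    "sat_at M (sat_at M B) = sat_at M B" "sat_at N (sat_at N B) = sat_at N B"
    using M N by auto
  have "a \<in> B" if "a \<in> sat_at M B" "a \<in> sat_at N B" for a
    using mem_of_mem_sat_at[OF B, of a] that supp by (auto simp: saturation_def)
  then show "sat_at M B \<inter> sat_at N B = B" using M(2) N(2) by blast
qed

lemma simple_if_two_intermediate:
  assumes F: "subalgebras S R = {R, A, B, carrier S}"
    and R: "R \<subseteq> A" "R \<subseteq> B" and AB: "\<not> A \<subseteq> B" "\<not> B \<subseteq> A"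
  shows "simple_ring_extension S R"
proof -
  obtain a b where ab: "a \<in> A" "a \<notin> B" "b \<in> B" "b \<notin> A" using AB by blast
  have sub: "subring A S" "subring B S" using F mem_subalgebras by auto
  have c: "a \<in> carrier S" "b \<in> carrier S" using ab sub subringE(1) by blast+
  have "a \<oplus> b \<notin> A"
  proof
    assume "a \<oplus> b \<in> A"
    then have "\<ominus> a \<oplus> (a \<oplus> b) \<in> A" using subringE(5,7)[OF sub(1)] ab by simp
    then show False using ab c by (simp add: r_neg1)
  qed
  moreover have "a \<oplus> b \<notin> B"
  proof
    assume "a \<oplus> b \<in> B"
    then have "(a \<oplus> b) \<oplus> \<ominus> b \<in> B" using subringE(5,7)[OF sub(2)] ab by simp
    then show False using ab c by (simp add: a_assoc r_neg)
  qed
  moreover have t: "a \<oplus> b \<in> carrier S" using c by simp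
  moreover have "simple_extension R (a \<oplus> b) \<in> subalgebras S R"
    using simple_extension_is_subring[OF R_subring t]
      simple_extension_incl[OF subringE(1)[OF R_subring] t] mem_subalgebras by blast
  moreover have "a \<oplus> b \<in> simple_extension R (a \<oplus> b)"
    by (rule simple_extension_mem[OF R_subring t])
  \<comment> \<open>The generated ring is one of the four, and \<open>R\<close>, \<open>A\<close>,
    \<open>B\<close> all miss \<open>a \<oplus> b\<close>.\<close>
  ultimately have "simple_extension R (a \<oplus> b) = carrier S" using R unfolding F by blast
  then show ?thesis unfolding simple_ring_extension_def using t by metis
qed

end

theorem proposition3p1:
  fixes S :: "('a, 'b) ring_scheme" and R :: "'a set"
  assumes "ring_extension S R"
    and "card (ext_support S R) = 2"
    and "ext_support S R \<subseteq> Max_Spec (S\<lparr>carrier := R\<rparr>)"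
  shows "(ext_length S R = 2 \<longleftrightarrow> locally_minimal S R)
       \<and> (locally_minimal S R \<longleftrightarrow> card (subalgebras S R) = 4)
       \<and> (ext_length S R = 2 \<and> locally_minimal S R \<and> card (subalgebras S R) = 4
            \<longrightarrow> simple_ring_extension S R)"
proof -
  interpret S: cring_with_subring S R
    using assms(1)
    by (auto simp: ring_extension_def cring_with_subring_def cring_with_subring_axioms_def)
  obtain M N where MN: "ext_support S R = {M, N}" "M \<noteq> N"
    using assms(2) by (auto simp: card_2_iff)
  have max: "maximalideal M (S\<lparr>carrier := R\<rparr>)" "maximalideal N (S\<lparr>carrier := R\<rparr>)"
    using assms(3) MN(1) by (auto simp: Max_Spec_def)
  \<comment> \<open>Maximality enters here: it makes the two primes of the support
    incomparable.\<close>
  have not_subset: "\<not> I \<subseteq> J"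
    if "maximalideal I (S\<lparr>carrier := R\<rparr>)" "maximalideal J (S\<lparr>carrier := R\<rparr>)" "I \<noteq> J" for I J
  proof -
    interpret I: maximalideal I "S\<lparr>carrier := R\<rparr>" by fact
    interpret J: maximalideal J "S\<lparr>carrier := R\<rparr>" by fact
    show ?thesis using I.I_maximal[OF J.is_ideal _ J.a_subset] J.I_notcarr that(3) by auto
  qed
  interpret C: complementary_closures "subalgebras S R" R "carrier S" "S.sat_at M" "S.sat_at N"
    by (rule S.complementary_closures_sat_at[OF MN(1) not_subset[OF max MN(2)]
          not_subset[OF max(2,1) MN(2)[symmetric]]])
  \<comment> \<open>Splitting the bounded conjunction yields one minimality statement for
    \<open>M\<close> and one for \<open>N\<close>.\<close>
  have local: "locally_minimal S R \<longleftrightarrow> C.closures_trivial"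
    unfolding C.closures_trivial_def ball_conj_distrib
      S.minimal_extension_at_iff[of M, symmetric, unfolded MN(1), OF insertI1]
      S.minimal_extension_at_iff[of N, symmetric, unfolded MN(1), OF insertI2[OF singletonI]]
    by (simp add: locally_minimal_def MN(1))
  \<comment> \<open>The numeral is brought to the form of \<open>ext_length_eq_iff\<close>. A chain
    of length 2 always exists, so only the absence of chains of length 3 remains as a
    condition.\<close>
  have "(2 :: enat) = enat 2" by (simp add: numeral_eq_enat)
  then have length: "ext_length S R = 2 \<longleftrightarrow> C.closures_trivial"
    using ext_length_eq_iff[of 2 S R] C.chain_2 C.chain_3_iff by simp
  have "simple_ring_extension S R" if C.closures_trivial
    using S.simple_if_two_intermediate[of "S.sat_at M R" "S.sat_at N R"] that
      C.closures_trivial_iff C.strict C.incomparable by blast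
  then show ?thesis using local length C.card_eq_4_iff by blast
qed

end
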